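(* Let $A,B\subseteq2^{\mathbb N}$. 1. $2^{\mathbb N}$ is c.e. comeager, co-c.e. comeager and c.e. comeager in the limit. 2. If $A$ is c.e. comeager, then $A$ contains a dense set of computable points and all 1-generic points. 3. If $A$ is c.e. comeager in the limit, then $A$ contains a dense set of 1-generic points which are computable in the limit. 4. If $A$ is c.e. comeager, then $A$ contains a set which is co-c.e. comeager. 5. If $A$ is c.e. comeager or co-c.e. comeager, then $A$ is also c.e. comeager in the limit. 6. If $A,B$ are both c.e. comeager, both co-c.e. comeager, or both c.e. comeager in the limit, then $A\cap B$ has the respective property. 7. The set of 1-generic points is c.e. comeager in the limit. 8. The set of non-computable points is a co-c.e. comeager set. 9. There is a co-c.e. comeager set that only contains points which are 1-generic; in particular this set contains no points of minimal Turing degree.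
   Context: $\mathcal A_-(2^{\mathbb N})$ is the represented space of closed subsets $A$ of $2^{\mathbb N}$, where a name of $A$ is an enumeration of basic open balls whose union is $2^{\mathbb N}\setminus A$ (the empty ball is allowed). $\mathcal A_+(2^{\mathbb N})$ is the same set, where a name of $A$ is a name of a sequence $(x_n)_n$ in $2^{\mathbb N}\sqcup\{\infty\}$ with $\overline{\{x_n:n\in\mathbb N\}}\cap2^{\mathbb N}=A$, with $\infty$ an added isolated point. For a represented space $(Y,\delta)$, $Y'$ denotes $Y$ with the representation $\delta\circ\lim$, where $\lim\langle p_0,p_1,\dots\rangle=\lim_np_n$ in $\mathbb N^{\mathbb N}$ (product topology) and $\langle p_0,p_1,\dots\rangle(\langle i,j\rangle):=p_i(j)$. A set $A\subseteq2^{\mathbb N}$ is c.e. comeager (respectively co-c.e. comeager) if there is a computable sequence $(A_i)_i$ in $\mathcal A_-(2^{\mathbb N})$ (respectively in $\mathcal A_+(2^{\mathbb N})$) such that all $A_i$ are nowhere dense and $2^{\mathbb N}\setminus A=\bigcup_{i=0}^\infty A_i$. The postfix "in the limit" means that the corresponding sequence is a computable sequence in $\mathcal A_-(2^{\mathbb N})'$ (respectively $\mathcal A_+(2^{\mathbb N})'$). For $q\in2^{\mathbb N}$ let $U_i^q:=\{p\in2^{\mathbb N}:\varphi_i^{\langle p,q\rangle}(0)\downarrow\}$, where $\varphi_i^r$ is the $i$-th partial function computable with oracle $r$. A point $p\in2^{\mathbb N}$ is 1-generic in $q$ if for all $i$ there is a finite prefix $w$ of $p$ with $w2^{\mathbb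 N}\subseteq U_i^q$ or $w2^{\mathbb N}\cap U_i^q=\emptyset$; $p$ is 1-generic if it is 1-generic in some computable $q$. A point is computable in the limit if it is the limit of a computable sequence of points. *)

theory Defs
  imports "HOL-Analysis.Analysis" "HOL-Library.Nat_Bijection"
begin

section \<open>Partial functions computable with an oracle\<close>

text \<open>
  Oracle programs denote partial functions on the natural numbers. Arguments are tupled with
  the Cantor pairing function \<open>prod_encode\<close>, whose inverse projections \<open>Left\<close> and \<open>Right\<close> are
  basic functions. \<open>PrimRec f g\<close> is primitive recursion with a parameter,
  \<open>h (y, 0) = f y\<close> and \<open>h (y, k + 1) = g (y, (k, h (y, k)))\<close>; \<open>Search f\<close> is unbounded search.
\<close>

datatype prog =
    Zero
  | Succ
  | Left
  | Right
  | Oracle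
  | Tuple prog prog
  | Compose prog prog
  | PrimRec prog prog
  | Search prog

definition least_zero :: "(nat \<Rightarrow> nat option) \<Rightarrow> nat option" where
  "least_zero f =
     (if \<exists>n. f n = Some 0 \<and> (\<forall>m<n. f m \<noteq> None) then Some (LEAST n. f n = Some 0) else None)"

primrec run :: "prog \<Rightarrow> (nat \<Rightarrow> nat) \<Rightarrow> nat \<Rightarrow> nat option" where
  "run Zero r x = Some 0"
| "run Succ r x = Some (Suc x)"
| "run Left r x = Some (fst (prod_decode x))"
| "run Right r x = Some (snd (prod_decode x))"
| "run Oracle r x = Some (r x)"
| "run (Tuple f g) r x =
     Option.bind (run f r x) (\<lambda>u. Option.bind (run g r x) (\<lambda>v. Some (prod_encode (u, v))))"
| "run (Compose f g) r x = Option.bind (run g r x) (run f r)"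
| "run (PrimRec f g) r x =
     (let (y, n) = prod_decode x
      in rec_nat (run f r y)
           (\<lambda>k h. Option.bind h (\<lambda>v. run g r (prod_encode (y, prod_encode (k, v))))) n)"
| "run (Search f) r x = least_zero (\<lambda>n. run f r (prod_encode (x, n)))"

text \<open>An explicit (bijective) Goedel numbering of the oracle programs.\<close>

function prog_of :: "nat \<Rightarrow> prog" where
  "prog_of n =
     (if n = 0 then Zero
      else if n = 1 then Succ
      else if n = 2 then Left
      else if n = 3 then Right
      else if n = 4 then Oracle
      else
        let k = (n - 5) div 4; a = fst (prod_decode k); b = snd (prod_decode k)
        in if (n - 5) mod 4 = 0 then Tuple (prog_of a) (prog_of b)
           else if (n - 5) mod 4 = 1 then Compose (prog_of a) (prog_of b)
           else if (n - 5) mod 4 = 2 then PrimRec (prog_of a) (prog_of b)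
           else Search (prog_of k))"
  by pat_completeness auto

lemma fst_prod_decode_le: "fst (prod_decode k) \<le> k"
  by (metis le_prod_encode_1 prod.collapse prod_decode_inverse)

lemma snd_prod_decode_le: "snd (prod_decode k) \<le> k"
  by (metis le_prod_encode_2 prod.collapse prod_decode_inverse)

lemma div4_less: "n \<noteq> 0 \<Longrightarrow> (n - 5) div 4 < (n::nat)"
  by presburger

termination prog_of
  by (relation "Wellfounded.measure id")
     (auto intro: le_less_trans[OF fst_prod_decode_le] le_less_trans[OF snd_prod_decode_le]
        div4_less)

declare prog_of.simps [simp del]

lemma add_mult4:
  "Suc (4 * k) div 4 = k" "Suc (4 * k) mod 4 = 1"
  "Suc (Suc (4 * k)) div 4 = k" "Suc (Suc (4 * k)) mod 4 = 2"
  "Suc (Suc (Suc (4 * k))) div 4 = k" "Suc (Suc (Suc (4 * k))) mod 4 = 3"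
  "(2 + 4 * k) div 4 = k" "(2 + 4 * k) mod 4 = 2"
  "(3 + 4 * k) div 4 = k" "(3 + 4 * k) mod 4 = (3::nat)"
  by presburger+

lemma surj_prog_of: "surj prog_of"
proof -
  have "\<exists>n. prog_of n = c" for c
  proof (induction c)
    case Zero
    have "prog_of 0 = Zero" by (simp add: prog_of.simps)
    then show ?case ..
  next
    case Succ
    have "prog_of 1 = Succ" by (simp add: prog_of.simps)
    then show ?case ..
  next
    case Left
    have "prog_of 2 = Left" by (simp add: prog_of.simps)
    then show ?case ..
  next
    case Right
    have "prog_of 3 = Right" by (simp add: prog_of.simps)
    then show ?case ..
  next
    case Oracle
    have "prog_of 4 = Oracle" by (simp add: prog_of.simps)
    then show ?case ..
  next
    case (Tuple f g)
    then obtain a b where "prog_of a = f" "prog_of b = g" by blast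
    then have "prog_of (5 + 4 * prod_encode (a, b)) = Tuple f g"
      by (subst prog_of.simps) (simp add: Let_def add_mult4)
    then show ?case ..
  next
    case (Compose f g)
    then obtain a b where "prog_of a = f" "prog_of b = g" by blast
    then have "prog_of (6 + 4 * prod_encode (a, b)) = Compose f g"
      by (subst prog_of.simps) (simp add: Let_def add_mult4)
    then show ?case ..
  next
    case (PrimRec f g)
    then obtain a b where "prog_of a = f" "prog_of b = g" by blast
    then have "prog_of (7 + 4 * prod_encode (a, b)) = PrimRec f g"
      by (subst prog_of.simps) (simp add: Let_def add_mult4)
    then show ?case ..
  next
    case (Search f)
    then obtain a where "prog_of a = f" by blast
    then have "prog_of (8 + 4 * a) = Search f"
      by (subst prog_of.simps) (simp add: Let_def add_mult4)
    then show ?case ..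
  qed
  then show ?thesis by (metis surjI)
qed

definition phi :: "nat \<Rightarrow> (nat \<Rightarrow> nat) \<Rightarrow> nat \<Rightarrow> nat option" where
  "phi i r = run (prog_of i) r"

text \<open>Computability without an oracle is computability with the constant zero oracle.\<close>

definition computable_fun :: "(nat \<Rightarrow> nat) \<Rightarrow> bool" where
  "computable_fun p \<longleftrightarrow> (\<exists>i. \<forall>n. phi i (\<lambda>_. 0) n = Some (p n))"


section \<open>Represented spaces\<close>

type_synonym 'y representation = "(nat \<Rightarrow> nat) \<Rightarrow> 'y option"

definition computable_point :: "'y representation \<Rightarrow> 'y \<Rightarrow> bool" where
  "computable_point \<delta> y \<longleftrightarrow> (\<exists>p. computable_fun p \<and> \<delta> p = Some y)"

text \<open>The components \<open>p\<^sub>i\<close> of \<open>p = \<langle>p\<^sub>0, p\<^sub>1, \<dots>\<rangle>\<close>.\<close>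

definition component :: "(nat \<Rightarrow> nat) \<Rightarrow> nat \<Rightarrow> nat \<Rightarrow> nat" where
  "component p i = (\<lambda>j. p (prod_encode (i, j)))"

definition seq_rep :: "'y representation \<Rightarrow> (nat \<Rightarrow> 'y) representation" where
  "seq_rep \<delta> p =
     (if \<forall>i. \<delta> (component p i) \<noteq> None then Some (\<lambda>i. the (\<delta> (component p i))) else None)"

definition computable_seq :: "'y representation \<Rightarrow> (nat \<Rightarrow> 'y) \<Rightarrow> bool" where
  "computable_seq \<delta> y \<longleftrightarrow> computable_point (seq_rep \<delta>) y"

text \<open>Limits are taken in the product topology of the discrete topology, hence are unique.\<close>

lemma baire_limit_unique:
  fixes X :: "nat \<Rightarrow> nat \<Rightarrow> nat"
  assumes "X \<longlonglongrightarrow> a" "X \<longlonglongrightarrow> b"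
  shows "a = b"
proof
  fix j
  have "continuous_on UNIV (\<lambda>x :: nat \<Rightarrow> nat. x j)"
    by (rule continuous_on_product_coordinates)
  then have "(\<lambda>n. X n j) \<longlonglongrightarrow> c j" if "X \<longlonglongrightarrow> c" for c
    by (rule continuous_on_tendsto_compose[where s = UNIV]) (use that in auto)
  then show "a j = b j"
    using assms LIMSEQ_unique by blast
qed

definition jump_rep :: "'y representation \<Rightarrow> 'y representation" where
  "jump_rep \<delta> p =
     (if convergent (component p) then \<delta> (THE q. component p \<longlonglongrightarrow> q) else None)"


section \<open>Cantor space and its closed subsets\<close>

type_synonym cantor = "nat \<Rightarrow> bool"

definition as_fun :: "cantor \<Rightarrow> nat \<Rightarrow> nat" where
  "as_fun x = (\<lambda>n. of_bool (x n))"

definition cantor_rep :: "cantor representation" where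
  "cantor_rep p = (if range p \<subseteq> {0, 1} then Some (\<lambda>n. p n = 1) else None)"

definition cylinder :: "bool list \<Rightarrow> cantor set" where
  "cylinder w = {x. \<forall>i<length w. x i = w ! i}"

text \<open>Bijective dyadic numbering of the binary words.\<close>

fun word :: "nat \<Rightarrow> bool list" where
  "word 0 = []"
| "word (Suc n) = odd n # word (n div 2)"

text \<open>The nonempty open balls of Cantor space are the cylinders.\<close>

fun basic_ball :: "nat \<Rightarrow> cantor set" where
  "basic_ball 0 = {}"
| "basic_ball (Suc n) = cylinder (word n)"

definition closed_neg_rep :: "cantor set representation" where
  "closed_neg_rep p = Some (- (\<Union>n. basic_ball (p n)))"

text \<open>
  The coproduct representation of Cantor space with an added point \<open>Inr ()\<close>: the first entry
  of a name decides between the two summands.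
\<close>

definition cantor_infty_rep :: "(cantor + unit) representation" where
  "cantor_infty_rep p =
     (if p 0 = 0 then map_option Inl (cantor_rep (\<lambda>n. p (Suc n)))
      else if p 0 = 1 then Some (Inr ())
      else None)"

text \<open>
  As the added point is isolated, intersecting the closure of the range of a sequence with
  Cantor space gives the closure, in Cantor space, of the members lying in Cantor space.
\<close>

definition closed_pos_rep :: "cantor set representation" where
  "closed_pos_rep p = map_option (\<lambda>s. closure (Inl -` range s)) (seq_rep cantor_infty_rep p)"


section \<open>Effective comeagerness\<close>

definition nowhere_dense :: "'a::topological_space set \<Rightarrow> bool" where
  "nowhere_dense S \<longleftrightarrow> interior (closure S) = {}"

definition comeager_wrt :: "cantor set representation \<Rightarrow> cantor set \<Rightarrow> bool" where
  "comeager_wrt \<delta> A \<longleftrightarrow>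
     (\<exists>C. computable_seq \<delta> C \<and> (\<forall>i. nowhere_dense (C i)) \<and> - A = (\<Union>i. C i))"

definition ce_comeager :: "cantor set \<Rightarrow> bool" where
  "ce_comeager = comeager_wrt closed_neg_rep"

definition co_ce_comeager :: "cantor set \<Rightarrow> bool" where
  "co_ce_comeager = comeager_wrt closed_pos_rep"

definition ce_comeager_in_the_limit :: "cantor set \<Rightarrow> bool" where
  "ce_comeager_in_the_limit = comeager_wrt (jump_rep closed_neg_rep)"


section \<open>Computable and generic points, Turing degrees\<close>

definition computable :: "cantor \<Rightarrow> bool" where
  "computable p \<longleftrightarrow> computable_point cantor_rep p"

definition computable_in_the_limit :: "cantor \<Rightarrow> bool" where
  "computable_in_the_limit p \<longleftrightarrow> (\<exists>x. computable_seq cantor_rep x \<and> x \<longlonglongrightarrow> p)"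

definition join :: "cantor \<Rightarrow> cantor \<Rightarrow> cantor" where
  "join p q = (\<lambda>n. if even n then p (n div 2) else q (n div 2))"

definition halting_open :: "nat \<Rightarrow> cantor \<Rightarrow> cantor set" where
  "halting_open i q = {p. phi i (as_fun (join p q)) 0 \<noteq> None}"

definition one_generic_in :: "cantor \<Rightarrow> cantor \<Rightarrow> bool" where
  "one_generic_in q p \<longleftrightarrow>
     (\<forall>i. \<exists>w. p \<in> cylinder w \<and>
        (cylinder w \<subseteq> halting_open i q \<or> cylinder w \<inter> halting_open i q = {}))"

definition one_generic :: "cantor \<Rightarrow> bool" where
  "one_generic p \<longleftrightarrow> (\<exists>q. computable q \<and> one_generic_in q p)"

definition turing_reducible :: "cantor \<Rightarrow> cantor \<Rightarrow> bool" where
  "turing_reducible p q \<longleftrightarrow> (\<exists>i. \<forall>n. phi i (as_fun q) n = Some (as_fun p n))"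

text \<open>The degree of \<open>p\<close> is nonzero, and no degree lies strictly between zero and it.\<close>

definition minimal_turing_degree :: "cantor \<Rightarrow> bool" where
  "minimal_turing_degree p \<longleftrightarrow>
     \<not> computable p \<and>
     (\<forall>q. turing_reducible q p \<longrightarrow> computable q \<or> turing_reducible p q)"

end

theory Submission
  imports Defs
begin

text \<open>
  The proof rests on four ideas, supported by a calculus of total recursive functionals and by a
  decidable predicate \<open>evaluated\<close> saying that a program computes a value within a given number of
  steps from a given finite part of its oracle (Kleene's \<open>T\<close> predicate).

  \<^bold>\<open>Boundaries.\<close> A point is 1-generic if and only if, for no \<open>i\<close>, it lies on the boundary of the
  halting set \<open>U\<^sub>i\<close> of the \<open>i\<close>-th program; a computable parameter \<open>q\<close> changes nothing, because the
  sets \<open>U\<^sub>i\<close> for the parameter zero reappear among those for \<open>q\<close>. Boundaries of open sets are closed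
  and nowhere dense. The complement of the boundary is the union of the cylinders that are contained
  in \<open>U\<^sub>i\<close> or disjoint from it; disjointness can only be refuted by search, so this is an enumeration
  in the limit, and the 1-generic points are c.e. comeager in the limit
  (\<open>one_generic_comeager_in_the_limit\<close>). For a positive name one enlarges the boundary: \<open>U\<^sub>i\<close> is the
  disjoint union of the cylinders of those words at which the program first halts. Choose one point in
  each of them. The chosen points are isolated from one another inside \<open>U\<^sub>i\<close> and accumulate exactly at
  the boundary, so their closure is still nowhere dense, contains the boundary, and has a computable
  dense sequence (\<open>co_ce_comeager_subset_one_generic\<close>). Every c.e. open dense set contains all
  1-generic points, since a condition cannot avoid a dense set; hence that single co-c.e. comeager
  set of 1-generic points lies inside every c.e. comeager set.

  \<^bold>\<open>Baire category.\<close> Given names of dense open sets, repeatedly replace a word by the first longer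
  word found whose cylinder lies in the next set. With computable names the limit point is computable
  (\<open>ce_comeager_dense_computable\<close>). With names in the limit, the same construction with searches bounded by
  \<open>s\<close> on the \<open>s\<close>-th approximation of the names stabilizes digit by digit as \<open>s\<close> grows, which makes the
  point computable in the limit (\<open>ce_comeager_in_the_limit_dense\<close>); intersecting with the 1-generic
  points beforehand makes it 1-generic too.

  \<^bold>\<open>Non-computable points.\<close> For each program take the sequence of its outputs computed within \<open>n\<close>
  steps, padded with zeros. The closure of this sequence consists of computable points and includes
  the point computed by the program, if there is one (\<open>noncomputable_co_ce_comeager\<close>).

  \<^bold>\<open>Degrees.\<close> The degree of a 1-generic point lies strictly above that of its even half, which is
  not computable (\<open>one_generic_not_minimal\<close>): if the even half were computed by a program, or the
  odd half by a program from the even half, then by genericity a finite prefix of the point would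
  already enforce this agreement for all its extensions, although the later digits are free.
\<close>

section \<open>Total recursive functionals\<close>

text \<open>
  One program must compute the functional uniformly in the oracle. The oracle is an argument of \<open>F\<close>
  so that the closure rules below also cover functionals like \<open>\<lambda>r x. r (f x)\<close>; multiple numerical
  arguments are passed through pairing. The rules have the form of introduction rules for
  \<open>\<lambda>r x. \<dots>\<close>, so that computability of a concrete term is proved by following its syntax.
\<close>

definition recursive :: "((nat \<Rightarrow> nat) \<Rightarrow> nat \<Rightarrow> nat) \<Rightarrow> bool" where
  "recursive F \<longleftrightarrow> (\<exists>P. \<forall>r x. run P r x = Some (F r x))"

definition decidable :: "((nat \<Rightarrow> nat) \<Rightarrow> nat \<Rightarrow> bool) \<Rightarrow> bool" where
  "decidable Q \<longleftrightarrow> recursive (\<lambda>r x. of_bool (Q r x))"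

abbreviation pfst :: "nat \<Rightarrow> nat" where "pfst n \<equiv> fst (prod_decode n)"
abbreviation psnd :: "nat \<Rightarrow> nat" where "psnd n \<equiv> snd (prod_decode n)"
abbreviation pair :: "nat \<Rightarrow> nat \<Rightarrow> nat" where "pair m n \<equiv> prod_encode (m, n)"

named_theorems recursive_intros

lemma recursiveI: "(\<And>r x. run P r x = Some (F r x)) \<Longrightarrow> recursive F"
  unfolding recursive_def by blast

lemma recursive_cong: "recursive F \<Longrightarrow> (\<And>r x. F r x = G r x) \<Longrightarrow> recursive G"
  unfolding recursive_def by simp

lemma decidable_cong: "decidable Q \<Longrightarrow> (\<And>r x. Q r x = R r x) \<Longrightarrow> decidable R"
  unfolding decidable_def by (erule recursive_cong) simp

lemma recursive_id [recursive_intros]: "recursive (\<lambda>r x. x)"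
  by (rule recursiveI[of "Tuple Left Right"]) simp

lemma recursive_compose:
  assumes "recursive F" "recursive G"
  shows "recursive (\<lambda>r x. F r (G r x))"
proof -
  from assms obtain P Q where
    "\<forall>r x. run P r x = Some (F r x)" "\<forall>r x. run Q r x = Some (G r x)"
    unfolding recursive_def by blast
  then show ?thesis by (intro recursiveI[of "Compose P Q"]) simp
qed

lemma recursive_Suc [recursive_intros]: "recursive F \<Longrightarrow> recursive (\<lambda>r x. Suc (F r x))"
  by (rule recursive_compose[of "\<lambda>r x. Suc x"]) (rule recursiveI[of Succ], simp)

lemma recursive_pfst [recursive_intros]: "recursive F \<Longrightarrow> recursive (\<lambda>r x. pfst (F r x))"
  by (rule recursive_compose[of "\<lambda>r x. pfst x"]) (rule recursiveI[of Left], simp)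

lemma recursive_psnd [recursive_intros]: "recursive F \<Longrightarrow> recursive (\<lambda>r x. psnd (F r x))"
  by (rule recursive_compose[of "\<lambda>r x. psnd x"]) (rule recursiveI[of Right], simp)

lemma recursive_oracle [recursive_intros]: "recursive F \<Longrightarrow> recursive (\<lambda>r x. r (F r x))"
  by (rule recursive_compose[of "\<lambda>r x. r x"]) (rule recursiveI[of Oracle], simp)

lemma recursive_pair [recursive_intros]:
  assumes "recursive F" "recursive G"
  shows "recursive (\<lambda>r x. pair (F r x) (G r x))"
proof -
  from assms obtain P Q where
    "\<forall>r x. run P r x = Some (F r x)" "\<forall>r x. run Q r x = Some (G r x)"
    unfolding recursive_def by blast
  then show ?thesis by (intro recursiveI[of "Tuple P Q"]) simp
qed

lemma recursive_const [recursive_intros]: "recursive (\<lambda>r x. c)"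
proof (induction c)
  case 0
  show ?case by (rule recursiveI[of Zero]) simp
next
  case (Suc c)
  then show ?case by (rule recursive_Suc)
qed

text \<open>
  The step function of a primitive recursion receives the parameter, the counter and the
  previous value packed into one number, as the program constructor demands.
\<close>

lemma recursive_rec_nat [recursive_intros]:
  assumes F: "recursive F"
    and G: "recursive (\<lambda>r t. G r (pfst t) (pfst (psnd t)) (psnd (psnd t)))"
    and N: "recursive N"
  shows "recursive (\<lambda>r x. rec_nat (F r x) (\<lambda>k h. G r x k h) (N r x))"
proof -
  from F G obtain P Q where P: "\<And>r x. run P r x = Some (F r x)"
    and Q: "\<And>r t. run Q r t = Some (G r (pfst t) (pfst (psnd t)) (psnd (psnd t)))"
    unfolding recursive_def by blast
  have *: "rec_nat (Some (F r x))
      (\<lambda>k h. Option.bind h (\<lambda>v. Some (G r x k v))) n = Some (rec_nat (F r x) (G r x) n)" for r x n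
    by (induction n) auto
  have "run (PrimRec P Q) r z
      = Some (rec_nat (F r (pfst z)) (G r (pfst z)) (psnd z))" for r z
    by (auto simp: P Q split: prod.split intro: *)
  then have "recursive (\<lambda>r z. rec_nat (F r (pfst z)) (G r (pfst z)) (psnd z))"
    by (rule recursiveI)
  from recursive_compose[OF this recursive_pair[OF recursive_id N]] show ?thesis
    by simp
qed

lemma recursive_if [recursive_intros]:
  assumes "decidable Q" "recursive F" "recursive G"
  shows "recursive (\<lambda>r x. if Q r x then F r x else G r x)"
proof -
  have "recursive (\<lambda>r x. rec_nat (G r x) (\<lambda>k h. F r x) (of_bool (Q r x)))"
    by (intro recursive_rec_nat recursive_compose[OF assms(2)] recursive_intros assms)
      (use assms(1) decidable_def in auto)
  moreover have "rec_nat (G r x) (\<lambda>k h. F r x) (of_bool (Q r x))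
      = (if Q r x then F r x else G r x)" for r x by simp
  ultimately show ?thesis by simp
qed

lemma recursive_of_bool [recursive_intros]:
  "decidable Q \<Longrightarrow> recursive (\<lambda>r x. of_bool (Q r x))"
  by (simp add: decidable_def)

lemma recursive_add [recursive_intros]:
  assumes "recursive F" "recursive G"
  shows "recursive (\<lambda>r x. F r x + G r x)"
proof -
  have "recursive (\<lambda>r x. rec_nat (F r x) (\<lambda>k h. Suc h) (G r x))"
    by (intro recursive_intros assms)
  moreover have "rec_nat m (\<lambda>k h. Suc h) n = m + n" for m n by (induction n) auto
  ultimately show ?thesis by simp
qed

lemma recursive_pred:
  assumes "recursive F"
  shows "recursive (\<lambda>r x. F r x - Suc 0)"
proof -
  have "recursive (\<lambda>r x. rec_nat 0 (\<lambda>k h. k) (F r x))"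
    by (intro recursive_intros assms)
  moreover have "rec_nat 0 (\<lambda>k h. k) n = n - Suc 0" for n by (cases n) auto
  ultimately show ?thesis by simp
qed

lemma recursive_diff [recursive_intros]:
  assumes "recursive F" "recursive G"
  shows "recursive (\<lambda>r x. F r x - G r x)"
proof -
  have "recursive (\<lambda>r x. rec_nat (F r x) (\<lambda>k h. h - Suc 0) (G r x))"
    by (intro recursive_intros recursive_pred assms)
  moreover have "rec_nat m (\<lambda>k h. h - Suc 0) n = m - n" for m n :: nat
    by (induction n) auto
  ultimately show ?thesis by simp
qed

lemma decidable_pos:
  assumes "recursive F"
  shows "decidable (\<lambda>r x. F r x \<noteq> 0)"
  unfolding decidable_def
  by (rule recursive_cong[of "\<lambda>r x. Suc 0 - (Suc 0 - F r x)"])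
    (intro recursive_intros assms, simp)

lemma decidable_compose:
  assumes "decidable Q" "recursive G"
  shows "decidable (\<lambda>r x. Q r (G r x))"
  using recursive_compose[of "\<lambda>r x. of_bool (Q r x)", OF _ assms(2)] assms(1)
  by (simp add: decidable_def)

lemma decidable_not [recursive_intros]:
  assumes "decidable Q"
  shows "decidable (\<lambda>r x. \<not> Q r x)"
  unfolding decidable_def
  by (rule recursive_cong[of "\<lambda>r x. if Q r x then 0 else Suc 0"])
    (intro recursive_intros assms, simp)

lemma decidable_conj [recursive_intros]:
  assumes "decidable Q" "decidable R"
  shows "decidable (\<lambda>r x. Q r x \<and> R r x)"
  unfolding decidable_def
  by (rule recursive_cong[of "\<lambda>r x. if Q r x then of_bool (R r x) else 0"])
    (intro recursive_intros assms, simp)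

lemma decidable_disj [recursive_intros]:
  assumes "decidable Q" "decidable R"
  shows "decidable (\<lambda>r x. Q r x \<or> R r x)"
  by (rule decidable_cong[OF decidable_not[OF decidable_conj[OF assms[THEN decidable_not]]]]) simp

lemma decidable_imp [recursive_intros]:
  assumes "decidable Q" "decidable R"
  shows "decidable (\<lambda>r x. Q r x \<longrightarrow> R r x)"
  by (rule decidable_cong[OF decidable_disj[OF decidable_not[OF assms(1)] assms(2)]]) simp

lemma decidable_less [recursive_intros]:
  assumes "recursive F" "recursive G"
  shows "decidable (\<lambda>r x. F r x < G r x)"
  by (rule decidable_cong[OF decidable_pos[OF recursive_diff[OF assms(2,1)]]]) auto

lemma decidable_le [recursive_intros]:
  assumes "recursive F" "recursive G"
  shows "decidable (\<lambda>r x. F r x \<le> G r x)"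
  by (rule decidable_cong[OF decidable_not[OF decidable_less[OF assms(2,1)]]]) auto

lemma decidable_eq [recursive_intros]:
  assumes "recursive F" "recursive G"
  shows "decidable (\<lambda>r x. F r x = G r x)"
  by (rule decidable_cong[OF decidable_conj[OF decidable_le[OF assms] decidable_le[OF assms(2,1)]]])
    auto

lemma decidable_iff [recursive_intros]:
  assumes "decidable Q" "decidable R"
  shows "decidable (\<lambda>r x. Q r x \<longleftrightarrow> R r x)"
  by (rule decidable_cong[OF decidable_eq[OF assms[THEN recursive_of_bool]]]) simp

text \<open>Bounded search returns the bound itself when it fails.\<close>

definition first_below :: "nat \<Rightarrow> (nat \<Rightarrow> bool) \<Rightarrow> nat" where
  "first_below n Q = (LEAST k. k = n \<or> Q k)"

lemma first_below_le: "first_below n Q \<le> n"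
  unfolding first_below_def by (rule Least_le) simp

lemma first_below_cases: "first_below n Q = n \<or> Q (first_below n Q)"
  unfolding first_below_def by (rule LeastI[of "\<lambda>k. k = n \<or> Q k" n]) simp

lemma first_below_minimal: "k < first_below n Q \<Longrightarrow> \<not> Q k"
  unfolding first_below_def using not_less_Least by blast

lemma first_below_less_iff: "first_below n Q < n \<longleftrightarrow> (\<exists>k<n. Q k)"
proof
  assume "first_below n Q < n"
  then show "\<exists>k<n. Q k" using first_below_cases[of n Q] by auto
next
  assume "\<exists>k<n. Q k"
  then obtain k where k: "k < n" "Q k" by blast
  then have "first_below n Q \<le> k" unfolding first_below_def by (intro Least_le) simp
  with k show "first_below n Q < n" by simp
qed

lemma first_below_eqI: "Q k \<Longrightarrow> k < n \<Longrightarrow> (\<And>j. j < k \<Longrightarrow> \<not> Q j) \<Longrightarrow> first_below n Q = k"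
  unfolding first_below_def by (rule Least_equality) (auto simp: not_less[symmetric])

lemma recursive_first_below [recursive_intros]:
  assumes N: "recursive N" and Q: "decidable (\<lambda>r t. Q r (pfst t) (psnd t))"
  shows "recursive (\<lambda>r x. first_below (N r x) (\<lambda>k. Q r x k))"
proof -
  have Q': "decidable (\<lambda>r t. Q r (A r t) (B r t))" if "recursive A" "recursive B" for A B
    using decidable_compose[OF Q recursive_pair[OF that]] by simp
  have "recursive (\<lambda>r x. rec_nat 0 (\<lambda>k h. if h = k \<and> \<not> Q r x k then Suc k else h) (N r x))"
    by (intro recursive_intros Q' N)
  moreover have "rec_nat 0 (\<lambda>k h. if h = k \<and> \<not> R k then Suc k else h) n = first_below n R"
    for R :: "nat \<Rightarrow> bool" and n
  proof (induction n)
    case 0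
    show ?case using first_below_le[of 0 R] by simp
  next
    case (Suc n)
    show ?case
    proof (cases "first_below n R < n")
      case True
      then have "first_below (Suc n) R = first_below n R"
        using first_below_cases[of n R] first_below_minimal[of _ n R]
        by (intro first_below_eqI) auto
      with Suc True show ?thesis by simp
    next
      case False
      then have no: "\<And>k. k < n \<Longrightarrow> \<not> R k" and eq: "first_below n R = n"
        using first_below_less_iff[of n R] first_below_le[of n R] by auto
      show ?thesis
      proof (cases "R n")
        case True
        then have "first_below (Suc n) R = n"
          by (intro first_below_eqI) (use no in auto)
        with Suc eq True show ?thesis by simp
      next
        case False
        then have "\<not> first_below (Suc n) R < Suc n"
          using no first_below_cases[of "Suc n" R] by (auto simp: less_Suc_eq)
        with Suc eq False first_below_le[of "Suc n" R] show ?thesis by simp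
      qed
    qed
  qed
  ultimately show ?thesis by simp
qed

lemma decidable_Ex_less [recursive_intros]:
  assumes N: "recursive N" and Q: "decidable (\<lambda>r t. Q r (pfst t) (psnd t))"
  shows "decidable (\<lambda>r x. \<exists>k<N r x. Q r x k)"
  by (rule decidable_cong[OF decidable_less[OF recursive_first_below[OF assms] N]])
    (rule first_below_less_iff)

lemma decidable_All_less [recursive_intros]:
  assumes N: "recursive N" and Q: "decidable (\<lambda>r t. Q r (pfst t) (psnd t))"
  shows "decidable (\<lambda>r x. \<forall>k<N r x. Q r x k)"
  by (rule decidable_cong[OF decidable_not[OF decidable_Ex_less[OF N decidable_not[OF Q]]]]) simp

lemma least_zero_total:
  assumes "\<exists>n. f n = 0"
  shows "least_zero (\<lambda>n. Some (f n)) = Some (LEAST n. f n = (0::nat))"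
  using assms by (simp add: least_zero_def)

text \<open>
  Unbounded search preserves totality only if the search succeeds on all arguments and oracles.
\<close>

lemma recursive_Least [recursive_intros]:
  assumes Q: "decidable (\<lambda>r t. Q r (pfst t) (psnd t))" and ex: "\<And>r x. \<exists>n. Q r x n"
  shows "recursive (\<lambda>r x. LEAST n. Q r x n)"
proof -
  have "recursive (\<lambda>r t. of_bool (\<not> Q r (pfst t) (psnd t)))"
    by (rule decidable_not[OF Q, unfolded decidable_def])
  then obtain P where P: "\<forall>r t. run P r t = Some (of_bool (\<not> Q r (pfst t) (psnd t)))"
    unfolding recursive_def ..
  have "run (Search P) r x = Some (LEAST n. Q r x n)" for r x
    using least_zero_total[of "\<lambda>n. of_bool (\<not> Q r x n)"] ex[of r x] by (simp add: P)
  then show ?thesis by (rule recursiveI)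
qed

lemma recursive_div2 [recursive_intros]:
  assumes "recursive F"
  shows "recursive (\<lambda>r x. F r x div 2)"
proof -
  have "recursive (\<lambda>r x. first_below (Suc (F r x)) (\<lambda>k. F r x < Suc (Suc (k + k))))"
    by (intro recursive_intros assms recursive_compose[OF assms])
  moreover have "first_below (Suc n) (\<lambda>k. n < Suc (Suc (k + k))) = n div 2" for n
    by (rule first_below_eqI) presburger+
  ultimately show ?thesis by simp
qed

lemma decidable_even [recursive_intros]:
  assumes "recursive F"
  shows "decidable (\<lambda>r x. even (F r x))"
proof -
  have "decidable (\<lambda>r x. F r x = F r x div 2 + F r x div 2)"
    by (intro recursive_intros assms)
  moreover have "even n \<longleftrightarrow> n = n div 2 + n div 2" for n :: nat by presburger
  ultimately show ?thesis by simp
qed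

lemma recursive_funpow [recursive_intros]:
  assumes G: "recursive (\<lambda>r x. g x)" and F: "recursive F" and N: "recursive N"
  shows "recursive (\<lambda>r x. (g ^^ N r x) (F r x))"
proof -
  have "recursive (\<lambda>r x. rec_nat (F r x) (\<lambda>k h. g h) (N r x))"
    by (intro recursive_rec_nat recursive_compose[OF G] recursive_intros F N)
  moreover have "rec_nat m (\<lambda>k h. g h) n = (g ^^ n) m" for m n by (induction n) auto
  ultimately show ?thesis by simp
qed

section \<open>Relative computability\<close>

primrec subst_oracle :: "prog \<Rightarrow> prog \<Rightarrow> prog" where
  "subst_oracle Q Zero = Zero"
| "subst_oracle Q Succ = Succ"
| "subst_oracle Q Left = Left"
| "subst_oracle Q Right = Right"
| "subst_oracle Q Oracle = Q"
| "subst_oracle Q (Tuple f g) = Tuple (subst_oracle Q f) (subst_oracle Q g)"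
| "subst_oracle Q (Compose f g) = Compose (subst_oracle Q f) (subst_oracle Q g)"
| "subst_oracle Q (PrimRec f g) = PrimRec (subst_oracle Q f) (subst_oracle Q g)"
| "subst_oracle Q (Search f) = Search (subst_oracle Q f)"

text \<open>
  Substitution expresses relative computability: a computation from \<open>s\<close> becomes one from \<open>r\<close> as soon as
  \<open>s\<close> is computable from \<open>r\<close>. Divergence is preserved too, so halting sets carry over.
\<close>

lemma run_subst_oracle:
  assumes "\<And>x. run Q r x = Some (s x)"
  shows "run (subst_oracle Q P) r x = run P s x"
proof -
  have "run (subst_oracle Q P) r = run P s"
    by (induction P) (auto simp: assms intro!: ext)
  then show ?thesis by simp
qed

text \<open>
  A program computing \<open>p\<close> from the zero oracle may diverge with other oracles; substituting the program
  \<open>Zero\<close> for the oracle makes it oblivious to the oracle, and then \<open>p\<close> enters the calculus above.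
\<close>

lemma computable_fun_iff: "computable_fun p \<longleftrightarrow> recursive (\<lambda>r. p)"
proof
  assume "computable_fun p"
  then obtain i where i: "\<And>n. run (prog_of i) (\<lambda>_. 0) n = Some (p n)"
    unfolding computable_fun_def phi_def by blast
  show "recursive (\<lambda>r. p)"
    by (rule recursiveI[of "subst_oracle Zero (prog_of i)"])
      (subst run_subst_oracle[where s = "\<lambda>_. 0"], auto simp: i)
next
  assume "recursive (\<lambda>r. p)"
  then obtain P where "\<And>r n. run P r n = Some (p n)" unfolding recursive_def by blast
  moreover obtain i where "prog_of i = P" using surj_prog_of by (metis surjD)
  ultimately show "computable_fun p" unfolding computable_fun_def phi_def by blast
qed

lemma computable_funI: "recursive (\<lambda>r. p) \<Longrightarrow> computable_fun p"
  by (simp add: computable_fun_iff)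

lemma recursive_computable_fun:
  "computable_fun p \<Longrightarrow> recursive F \<Longrightarrow> recursive (\<lambda>r x. p (F r x))"
  using recursive_compose[of "\<lambda>r. p" F] by (simp add: computable_fun_iff)

section \<open>Binary words and the topology of Cantor space\<close>

definition wlen :: "nat \<Rightarrow> nat" where
  "wlen n = length (word n)"

text \<open>
  The digits of a word are read off a point of Cantor space, its extension by zeros. Then words, their
  cylinders and computable points share one language.
\<close>

definition padded :: "nat \<Rightarrow> cantor" where
  "padded n = (\<lambda>j. j < wlen n \<and> word n ! j)"

lemma word_eq_Nil_iff: "word n = [] \<longleftrightarrow> n = 0"
  by (cases n) auto

lemma word_funpow_tail: "word (((\<lambda>n. (n - Suc 0) div 2) ^^ j) n) = drop j (word n)"
proof -
  have "word ((m - Suc 0) div 2) = tl (word m)" for m by (cases m) auto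
  then show ?thesis by (induction j) (auto simp: drop_Suc tl_drop)
qed

lemma less_wlen_iff: "j < wlen n \<longleftrightarrow> ((\<lambda>n. (n - Suc 0) div 2) ^^ j) n \<noteq> 0"
  unfolding word_eq_Nil_iff[symmetric] word_funpow_tail wlen_def by auto

text \<open>
  The numbering of words is arithmetical: the first letter of \<open>word (Suc n)\<close> is the parity of \<open>n\<close>, and
  removing it leads to the number \<open>n div 2\<close>. Iterating this step gives access to every letter.
\<close>

lemma padded_iff:
  "padded n j \<longleftrightarrow> j < wlen n \<and> odd (((\<lambda>n. (n - Suc 0) div 2) ^^ j) n - Suc 0)"
proof (cases "j < wlen n")
  case True
  then obtain m where m: "((\<lambda>n. (n - Suc 0) div 2) ^^ j) n = Suc m"
    using less_wlen_iff not0_implies_Suc by blast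
  have "word n ! j = hd (drop j (word n))" using True by (simp add: wlen_def hd_drop_conv_nth)
  also have "drop j (word n) = word (Suc m)" using word_funpow_tail[of j n] m by metis
  also have "hd \<dots> = odd m" by simp
  finally show ?thesis using True m by (simp add: padded_def)
qed (simp add: padded_def)

lemma wlen_le: "wlen n \<le> n"
proof (induction n rule: word.induct)
  case (2 n)
  then show ?case by (simp add: wlen_def)
qed (simp add: wlen_def)

lemma decidable_less_wlen [recursive_intros]:
  assumes "recursive F" "recursive G"
  shows "decidable (\<lambda>r x. F r x < wlen (G r x))"
  unfolding less_wlen_iff by (intro recursive_intros recursive_pred assms)

text \<open>
  The length is the first position that is not occupied; the word number itself bounds the search.
\<close>

lemma recursive_wlen [recursive_intros]:
  assumes "recursive F"
  shows "recursive (\<lambda>r x. wlen (F r x))"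
proof -
  have "recursive (\<lambda>r x. first_below (F r x) (\<lambda>k. \<not> k < wlen (F r x)))"
    by (intro recursive_intros assms recursive_compose[OF assms])
  moreover have "first_below n (\<lambda>k. \<not> k < wlen n) = wlen n" for n
    unfolding first_below_def by (rule Least_equality) (use wlen_le in auto)
  ultimately show ?thesis by simp
qed

lemma decidable_padded [recursive_intros]:
  assumes "recursive F" "recursive G"
  shows "decidable (\<lambda>r x. padded (F r x) (G r x))"
  unfolding padded_iff by (intro recursive_intros recursive_pred assms)

lemma surj_word: "surj word"
proof -
  have "\<exists>n. word n = w" for w
  proof (induction w)
    case Nil
    have "word 0 = []" by simp
    then show ?case ..
  next
    case (Cons b w)
    then obtain n where "word n = w" ..
    then have "word (Suc (2 * n + of_bool b)) = b # w" by auto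
    then show ?case ..
  qed
  then show ?thesis by (metis surjI)
qed

definition prefix_code :: "cantor \<Rightarrow> nat \<Rightarrow> nat" where
  "prefix_code x l = inv word (map x [0..<l])"

lemma word_prefix_code: "word (prefix_code x l) = map x [0..<l]"
  unfolding prefix_code_def by (rule surj_f_inv_f[OF surj_word])

lemma wlen_prefix_code [simp]: "wlen (prefix_code x l) = l"
  by (simp add: wlen_def word_prefix_code)

lemma padded_prefix_code: "padded (prefix_code x l) j \<longleftrightarrow> j < l \<and> x j"
  by (auto simp: padded_def wlen_def word_prefix_code)

lemma mem_cylinder_word: "x \<in> cylinder (word n) \<longleftrightarrow> (\<forall>j<wlen n. x j = padded n j)"
  by (auto simp: cylinder_def padded_def wlen_def)

lemma mem_cylinder_prefix_code: "y \<in> cylinder (word (prefix_code x l)) \<longleftrightarrow> (\<forall>j<l. y j = x j)"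
  by (auto simp: mem_cylinder_word padded_prefix_code)

lemma padded_in_cylinder: "padded n \<in> cylinder (word n)"
  by (simp add: mem_cylinder_word)

lemma open_coordinate: "open {y :: nat \<Rightarrow> 'a::discrete_topology. y j = c}"
proof -
  have "open ((\<lambda>y :: nat \<Rightarrow> 'a. y j) -` {c})"
    by (intro open_vimage continuous_on_product_coordinates open_discrete)
  then show ?thesis by (simp add: vimage_def)
qed

text \<open>A basic open box restricts only finitely many coordinates, and these lie below some bound.\<close>

lemma open_sequences_iff:
  fixes S :: "(nat \<Rightarrow> 'a::discrete_topology) set"
  shows "open S \<longleftrightarrow> (\<forall>x\<in>S. \<exists>l. \<forall>y. (\<forall>j<l. y j = x j) \<longrightarrow> y \<in> S)"
proof
  assume "open S"
  show "\<forall>x\<in>S. \<exists>l. \<forall>y. (\<forall>j<l. y j = x j) \<longrightarrow> y \<in> S"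
  proof
    fix x assume "x \<in> S"
    obtain X where X: "x \<in> (\<Pi>\<^sub>E i\<in>UNIV. X i)" "finite {i. X i \<noteq> (UNIV :: 'a set)}"
        "(\<Pi>\<^sub>E i\<in>UNIV. X i) \<subseteq> S"
      using product_topology_open_contains_basis[of "\<lambda>_. euclidean :: 'a topology" UNIV S x]
        \<open>open S\<close> \<open>x \<in> S\<close> by (auto simp: open_fun_def)
    obtain l where "{i. X i \<noteq> UNIV} \<subseteq> {..<l}"
      using X(2) unfolding finite_nat_iff_bounded by blast
    then have l: "i < l" if "X i \<noteq> UNIV" for i using that by blast
    have "y \<in> S" if "\<forall>j<l. y j = x j" for y
    proof -
      have "y i \<in> X i" for i using X(1) l[of i] that by (cases "X i = UNIV") auto
      then show ?thesis using X(3) by auto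
    qed
    then show "\<exists>l. \<forall>y. (\<forall>j<l. y j = x j) \<longrightarrow> y \<in> S" by blast
  qed
next
  assume *: "\<forall>x\<in>S. \<exists>l. \<forall>y. (\<forall>j<l. y j = x j) \<longrightarrow> y \<in> S"
  show "open S"
  proof (subst open_subopen, intro ballI)
    fix x assume "x \<in> S"
    with * obtain l where l: "\<And>y. (\<forall>j<l. y j = x j) \<Longrightarrow> y \<in> S" by blast
    have "open (\<Inter>j\<in>{..<l}. {y. y j = x j})" by (intro open_INT ballI open_coordinate) auto
    moreover have "(\<Inter>j\<in>{..<l}. {y. y j = x j}) \<subseteq> S" using l by auto
    ultimately show "\<exists>T. open T \<and> x \<in> T \<and> T \<subseteq> S" by blast
  qed
qed

lemma tendsto_sequences_iff:
  fixes X :: "nat \<Rightarrow> nat \<Rightarrow> 'a::discrete_topology"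
  shows "X \<longlonglongrightarrow> q \<longleftrightarrow> (\<forall>j. eventually (\<lambda>s. X s j = q j) sequentially)"
proof
  assume "X \<longlonglongrightarrow> q"
  then show "\<forall>j. eventually (\<lambda>s. X s j = q j) sequentially"
    using topological_tendstoD[OF _ open_coordinate] by fastforce
next
  assume *: "\<forall>j. eventually (\<lambda>s. X s j = q j) sequentially"
  show "X \<longlonglongrightarrow> q"
  proof (rule topological_tendstoI)
    fix S :: "(nat \<Rightarrow> 'a) set" assume "open S" "q \<in> S"
    then obtain l where l: "\<And>y. (\<forall>j<l. y j = q j) \<Longrightarrow> y \<in> S"
      unfolding open_sequences_iff by blast
    have "eventually (\<lambda>s. \<forall>j\<in>{..<l}. X s j = q j) sequentially"
      by (rule eventually_ball_finite) (use * in auto)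
    then show "eventually (\<lambda>s. X s \<in> S) sequentially"
      by (rule eventually_mono) (use l in auto)
  qed
qed

lemma open_cylinder: "open (cylinder w)"
  unfolding open_sequences_iff cylinder_def by auto

lemma mem_closure_sequences:
  fixes S :: "(nat \<Rightarrow> 'a::discrete_topology) set"
  shows "x \<in> closure S \<longleftrightarrow> (\<forall>l. \<exists>y\<in>S. \<forall>j<l. y j = x j)"
proof
  assume x: "x \<in> closure S"
  show "\<forall>l. \<exists>y\<in>S. \<forall>j<l. y j = x j"
  proof
    fix l
    have "open {y. \<forall>j<l. y j = x j}"
      unfolding open_sequences_iff by (intro ballI exI[of _ l]) auto
    then have "{y. \<forall>j<l. y j = x j} \<inter> S \<noteq> {}"
      using x open_Int_closure_eq_empty[of "{y. \<forall>j<l. y j = x j}" S] by blast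
    then show "\<exists>y\<in>S. \<forall>j<l. y j = x j" by blast
  qed
next
  assume *: "\<forall>l. \<exists>y\<in>S. \<forall>j<l. y j = x j"
  show "x \<in> closure S"
  proof (rule ccontr)
    assume "x \<notin> closure S"
    moreover have "\<forall>x\<in>- closure S. \<exists>l. \<forall>y. (\<forall>j<l. y j = x j) \<longrightarrow> y \<in> - closure S"
      using open_Compl[OF closed_closure[of S]] unfolding open_sequences_iff .
    ultimately obtain l where l: "\<forall>y. (\<forall>j<l. y j = x j) \<longrightarrow> y \<in> - closure S"
      by (metis ComplI)
    obtain y where "y \<in> S" "\<forall>j<l. y j = x j" using * by metis
    with l have "y \<in> - closure S" by simp
    with \<open>y \<in> S\<close> closure_subset show False by blast
  qed
qed

lemma open_imp_cylinder:
  fixes S :: "cantor set"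
  assumes "open S" "x \<in> S"
  obtains n where "x \<in> cylinder (word n)" "cylinder (word n) \<subseteq> S"
proof -
  from assms obtain l where l: "\<And>y. (\<forall>j<l. y j = x j) \<Longrightarrow> y \<in> S"
    unfolding open_sequences_iff by blast
  show thesis
    by (rule that[of "prefix_code x l"]) (use l in \<open>auto simp: mem_cylinder_prefix_code\<close>)
qed

lemma nowhere_dense_iff:
  fixes S :: "cantor set"
  shows "nowhere_dense S \<longleftrightarrow> (\<forall>n. \<not> cylinder (word n) \<subseteq> closure S)"
proof
  show "\<forall>n. \<not> cylinder (word n) \<subseteq> closure S" if "nowhere_dense S"
    using that interior_maximal[OF _ open_cylinder] padded_in_cylinder
    unfolding nowhere_dense_def by blast
next
  assume *: "\<forall>n. \<not> cylinder (word n) \<subseteq> closure S"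
  have "x \<notin> interior (closure S)" for x
  proof
    assume "x \<in> interior (closure S)"
    then obtain n where "cylinder (word n) \<subseteq> interior (closure S)"
      using open_imp_cylinder[OF open_interior] by metis
    with * show False using interior_subset by blast
  qed
  then show "nowhere_dense S" by (auto simp: nowhere_dense_def)
qed

section \<open>A universal bounded evaluator\<close>

lemma decidable_if [recursive_intros]:
  assumes "decidable Q" "decidable R" "decidable S"
  shows "decidable (\<lambda>r x. if Q r x then R r x else S r x)"
proof (rule decidable_cong)
  show "decidable (\<lambda>r x. (Q r x \<and> R r x) \<or> (\<not> Q r x \<and> S r x))"
    by (intro recursive_intros assms)
qed auto

lemma recursive_div4 [recursive_intros]:
  assumes "recursive F"
  shows "recursive (\<lambda>r x. F r x div 4)"
proof (rule recursive_cong)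
  show "recursive (\<lambda>r x. F r x div 2 div 2)" by (intro recursive_intros assms)
qed (simp add: div_mult2_eq[symmetric])

lemma recursive_mod4 [recursive_intros]:
  assumes "recursive F"
  shows "recursive (\<lambda>r x. F r x mod 4)"
proof (rule recursive_cong)
  show "recursive (\<lambda>r x. F r x - (F r x div 4 + F r x div 4 + F r x div 4 + F r x div 4))"
    by (intro recursive_intros assms)
  show "n - (n div 4 + n div 4 + n div 4 + n div 4) = n mod 4" for n :: nat by presburger
qed

text \<open>
  A number codes, through \<open>list_encode\<close>, a finite list, and computations will be such lists. Membership
  is decidable because iterating the tail of the code exhausts the list.
\<close>

definition code_members :: "nat \<Rightarrow> nat set" where
  "code_members c = set (list_decode c)"

lemma list_decode_eq_Nil_iff: "list_decode c = [] \<longleftrightarrow> c = 0"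
  by (cases c) (auto split: prod.split)

definition code_drop :: "nat \<Rightarrow> nat \<Rightarrow> nat" where
  "code_drop j c = ((\<lambda>c. psnd (c - Suc 0)) ^^ j) c"

lemma recursive_code_drop [recursive_intros]:
  assumes "recursive F" "recursive G"
  shows "recursive (\<lambda>r x. code_drop (F r x) (G r x))"
  unfolding code_drop_def by (intro recursive_intros recursive_pred assms)

lemma list_decode_code_drop: "list_decode (code_drop j c) = drop j (list_decode c)"
proof -
  have "list_decode (psnd (c - Suc 0)) = tl (list_decode c)" for c
  proof (cases c)
    case 0
    have "prod_encode (0, 0) = 0" by (simp add: prod_encode_def)
    then have "prod_decode 0 = (0, 0)" by (metis prod_encode_inverse)
    with 0 show ?thesis by simp
  qed (simp add: case_prod_beta)
  then show ?thesis unfolding code_drop_def by (induction j) (auto simp: drop_Suc tl_drop)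
qed

lemma less_length_list_decode_iff:
  "j < length (list_decode c) \<longleftrightarrow> code_drop j c \<noteq> 0"
  unfolding list_decode_eq_Nil_iff[symmetric] list_decode_code_drop by auto

lemma nth_list_decode:
  assumes "j < length (list_decode c)"
  shows "list_decode c ! j = pfst (code_drop j c - Suc 0)"
proof -
  have "hd (list_decode d) = pfst (d - Suc 0)" if "d \<noteq> 0" for d
    using that by (cases d) (auto simp: case_prod_beta)
  then have "pfst (code_drop j c - Suc 0) = hd (drop j (list_decode c))"
    using assms less_length_list_decode_iff list_decode_code_drop by metis
  then show ?thesis using assms by (simp add: hd_drop_conv_nth)
qed

lemma length_list_decode_le: "length (list_decode c) \<le> c"
proof -
  have "length xs \<le> list_encode xs" for xs
  proof (induction xs)
    case (Cons x xs)
    then show ?case using le_prod_encode_2[of "list_encode xs" x] by simp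
  qed simp
  from this[of "list_decode c"] show ?thesis by simp
qed

lemma code_members_less: "e \<in> code_members c \<Longrightarrow> e < c"
proof -
  have "e \<in> set xs \<Longrightarrow> e < list_encode xs" for xs
  proof (induction xs)
    case (Cons x xs)
    then show ?case
      using le_prod_encode_1[of x "list_encode xs"] le_prod_encode_2[of "list_encode xs" x]
      by auto
  qed simp
  from this[of "list_decode c"] show "e \<in> code_members c \<Longrightarrow> e < c"
    by (simp add: code_members_def)
qed

lemma decidable_code_members [recursive_intros]:
  assumes E: "recursive E" and C: "recursive C"
  shows "decidable (\<lambda>r x. E r x \<in> code_members (C r x))"
proof (rule decidable_cong)
  show "decidable (\<lambda>r x. \<exists>j<C r x. code_drop j (C r x) \<noteq> 0 \<and> pfst (code_drop j (C r x) - Suc 0) = E r x)"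
    by (intro recursive_intros recursive_pred C recursive_compose[OF C] recursive_compose[OF E])
  show "(\<exists>j<c. code_drop j c \<noteq> 0 \<and> pfst (code_drop j c - Suc 0) = e) \<longleftrightarrow> e \<in> code_members c" for e c
  proof -
    have "(\<exists>j<c. code_drop j c \<noteq> 0 \<and> pfst (code_drop j c - Suc 0) = e)
        \<longleftrightarrow> (\<exists>j<length (list_decode c). list_decode c ! j = e)"
      using nth_list_decode less_length_list_decode_iff length_list_decode_le less_le_trans by metis
    then show ?thesis by (simp add: code_members_def in_set_conv_nth)
  qed
qed

abbreviation triple :: "nat \<Rightarrow> nat \<Rightarrow> nat \<Rightarrow> nat" where
  "triple i x v \<equiv> pair i (pair x v)"

text \<open>
  A triple \<open>(i, x, v)\<close> asserts that program \<open>i\<close> maps \<open>x\<close> to \<open>v\<close>. It is justified by \<open>R\<close> if one application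
  of the defining equations of \<open>run\<close> derives it from assertions in \<open>R\<close>. Only the first \<open>l\<close> values of the
  oracle may be used, which makes the use of a computation explicit. The branching follows the Goedel
  numbering \<open>prog_of\<close>.
\<close>

definition justified :: "(nat \<Rightarrow> nat) \<Rightarrow> nat \<Rightarrow> nat set \<Rightarrow> nat \<Rightarrow> nat \<Rightarrow> nat \<Rightarrow> bool" where
  "justified r l R i x v \<longleftrightarrow>
     (if i = 0 then v = 0
      else if i = 1 then v = Suc x
      else if i = 2 then v = pfst x
      else if i = 3 then v = psnd x
      else if i = 4 then x < l \<and> v = r x
      else
        let k = (i - 5) div 4; a = pfst k; b = psnd k
        in if (i - 5) mod 4 = 0 then triple a x (pfst v) \<in> R \<and> triple b x (psnd v) \<in> R
           else if (i - 5) mod 4 = 1 then \<exists>m. triple b x m \<in> R \<and> triple a m v \<in> R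
           else if (i - 5) mod 4 = 2 then
             if psnd x = 0 then triple a (pfst x) v \<in> R
             else \<exists>h. triple i (pair (pfst x) (psnd x - Suc 0)) h \<in> R
                    \<and> triple b (triple (pfst x) (psnd x - Suc 0) h) v \<in> R
           else triple k (pair x v) 0 \<in> R \<and> (\<forall>m<v. \<exists>h. triple k (pair x m) (Suc h) \<in> R))"

lemma justified_mono:
  assumes "justified r l R i x v" "R \<subseteq> R'" "l \<le> l'"
  shows "justified r l' R' i x v"
proof -
  have if_mono: "(if c then A else B) \<Longrightarrow> (A \<Longrightarrow> A') \<Longrightarrow> (B \<Longrightarrow> B') \<Longrightarrow> if c then A' else B'"
    for c A A' B B' by simp
  have sub: "e \<in> R'" if "e \<in> R" for e using that assms(2) by blast
  have lt: "x < l'" if "x < l" using that assms(3) by simp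
  show ?thesis using assms(1) unfolding justified_def Let_def
    by (elim if_mono) (use sub lt in blast)+
qed

text \<open>
  Each entry is justified by the entries behind it, so that the order of the list excludes circular
  justifications.
\<close>

primrec valid_table :: "(nat \<Rightarrow> nat) \<Rightarrow> nat \<Rightarrow> nat list \<Rightarrow> bool" where
  "valid_table r l [] \<longleftrightarrow> True"
| "valid_table r l (e # es) \<longleftrightarrow>
     justified r l (set es) (pfst e) (pfst (psnd e)) (psnd (psnd e)) \<and> valid_table r l es"

lemma valid_table_append:
  "valid_table r l xs \<Longrightarrow> valid_table r l ys \<Longrightarrow> valid_table r l (xs @ ys)"
  by (induction xs) (auto intro: justified_mono)

lemma valid_table_mono: "valid_table r l xs \<Longrightarrow> l \<le> l' \<Longrightarrow> valid_table r l' xs"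
  by (induction xs) (auto intro: justified_mono)

lemma valid_table_iff:
  "valid_table r l xs \<longleftrightarrow> (\<forall>j<length xs.
     justified r l (set (drop (Suc j) xs)) (pfst (xs ! j)) (pfst (psnd (xs ! j))) (psnd (psnd (xs ! j))))"
  by (induction xs) (auto simp: All_less_Suc2)

lemma triple_members_less:
  assumes "triple i x v \<in> code_members c"
  shows "i < c" "x < c" "v < c"
  using code_members_less[OF assms] le_prod_encode_1[of i "pair x v"] le_prod_encode_2[of "pair x v" i]
    le_prod_encode_1[of x v] le_prod_encode_2[of v x] by simp_all

text \<open>
  The quantifiers over intermediate values in the definition of \<open>justified\<close> are bounded: a value that
  occurs in a list is smaller than the code of the list.
\<close>

lemma decidable_justified [recursive_intros]:
  assumes R: "recursive (\<lambda>r t. \<rho> r (pfst t) (psnd t))"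
    and L: "recursive L" and C: "recursive C" and I: "recursive I" and X: "recursive X" and V: "recursive V"
  shows "decidable (\<lambda>r z. justified (\<rho> r z) (L r z) (code_members (C r z)) (I r z) (X r z) (V r z))"
proof -
  have R': "recursive (\<lambda>r t. \<rho> r (A r t) (B r t))" if "recursive A" "recursive B" for A B
    using recursive_compose[OF R recursive_pair[OF that]] by simp
  note c = C I X V
  (* Under a bounded quantifier the parameters occur composed with a projection. *)
  note cc = C[THEN recursive_compose] I[THEN recursive_compose] X[THEN recursive_compose]
    V[THEN recursive_compose]
  have *: "justified r l (code_members c) i x v \<longleftrightarrow>
     (if i = 0 then v = 0
      else if i = 1 then v = Suc x
      else if i = 2 then v = pfst x
      else if i = 3 then v = psnd x
      else if i = 4 then x < l \<and> v = r x
      else if (i - 5) mod 4 = 0 then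
        triple (pfst ((i - 5) div 4)) x (pfst v) \<in> code_members c \<and>
        triple (psnd ((i - 5) div 4)) x (psnd v) \<in> code_members c
      else if (i - 5) mod 4 = 1 then
        \<exists>m<c. triple (psnd ((i - 5) div 4)) x m \<in> code_members c \<and>
             triple (pfst ((i - 5) div 4)) m v \<in> code_members c
      else if (i - 5) mod 4 = 2 then
        if psnd x = 0 then triple (pfst ((i - 5) div 4)) (pfst x) v \<in> code_members c
        else \<exists>h<c. triple i (pair (pfst x) (psnd x - Suc 0)) h \<in> code_members c
               \<and> triple (psnd ((i - 5) div 4)) (triple (pfst x) (psnd x - Suc 0) h) v \<in> code_members c
      else triple ((i - 5) div 4) (pair x v) 0 \<in> code_members c \<and>
        (\<forall>m<v. \<exists>h<c. triple ((i - 5) div 4) (pair x m) (Suc h) \<in> code_members c))"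
    for r :: "nat \<Rightarrow> nat" and l c i x v
  proof -
    have 1: "(\<exists>m. triple a x m \<in> code_members c \<and> P m) \<longleftrightarrow>
        (\<exists>m<c. triple a x m \<in> code_members c \<and> P m)" for a x P
      using triple_members_less(3) by blast
    have 2: "(\<exists>h. triple a x (Suc h) \<in> code_members c) \<longleftrightarrow>
        (\<exists>h<c. triple a x (Suc h) \<in> code_members c)" for a x
      using triple_members_less(3) Suc_lessD by blast
    show ?thesis unfolding justified_def Let_def 1 2 ..
  qed
  show ?thesis unfolding *
    by (intro recursive_intros recursive_pred R' L c cc)
qed

lemma decidable_valid_table [recursive_intros]:
  assumes R: "recursive (\<lambda>r t. \<rho> r (pfst t) (psnd t))" and L: "recursive L" and C: "recursive C"
  shows "decidable (\<lambda>r z. valid_table (\<rho> r z) (L r z) (list_decode (C r z)))"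
proof (rule decidable_cong)
  have R': "recursive (\<lambda>r t. \<rho> r (A r t) (B r t))" if "recursive A" "recursive B" for A B
    using recursive_compose[OF R recursive_pair[OF that]] by simp
  show "decidable (\<lambda>r z. \<forall>j<C r z. code_drop j (C r z) \<noteq> 0 \<longrightarrow>
      justified (\<rho> r z) (L r z) (code_members (code_drop (Suc j) (C r z)))
        (pfst (pfst (code_drop j (C r z) - Suc 0)))
        (pfst (psnd (pfst (code_drop j (C r z) - Suc 0))))
        (psnd (psnd (pfst (code_drop j (C r z) - Suc 0)))))"
    by (intro recursive_intros recursive_pred R' L C recursive_compose[OF C] recursive_compose[OF L])
  show "(\<forall>j<c. code_drop j c \<noteq> 0 \<longrightarrow>
      justified r l (code_members (code_drop (Suc j) c)) (pfst (pfst (code_drop j c - Suc 0)))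
        (pfst (psnd (pfst (code_drop j c - Suc 0)))) (psnd (psnd (pfst (code_drop j c - Suc 0)))))
    \<longleftrightarrow> valid_table r l (list_decode c)" for c l and r :: "nat \<Rightarrow> nat"
  proof -
    have "(\<forall>j<c. code_drop j c \<noteq> 0 \<longrightarrow> P j (pfst (code_drop j c - Suc 0)))
        \<longleftrightarrow> (\<forall>j<length (list_decode c). P j (list_decode c ! j))" for P
      using nth_list_decode less_length_list_decode_iff length_list_decode_le less_le_trans by metis
    then show ?thesis unfolding valid_table_iff code_members_def list_decode_code_drop .
  qed
qed

lemma prog_of_rec:
  assumes "\<not> i < 5"
  shows "prog_of i =
    (let k = (i - 5) div 4; a = pfst k; b = psnd k
     in if (i - 5) mod 4 = 0 then Tuple (prog_of a) (prog_of b)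
        else if (i - 5) mod 4 = 1 then Compose (prog_of a) (prog_of b)
        else if (i - 5) mod 4 = 2 then PrimRec (prog_of a) (prog_of b)
        else Search (prog_of k))"
  using assms by (subst prog_of.simps) (simp add: Let_def)

lemma prog_of_base:
  "prog_of 0 = Zero" "prog_of (Suc 0) = Succ" "prog_of 2 = Left" "prog_of 3 = Right" "prog_of 4 = Oracle"
  by (simp_all add: prog_of.simps)

lemma less_5_cases: "i < 5 \<Longrightarrow> i = 0 \<or> i = 1 \<or> i = 2 \<or> i = 3 \<or> i = (4::nat)"
  by arith

lemma run_PrimRec_0: "psnd x = 0 \<Longrightarrow> run (PrimRec f g) r x = run f r (pfst x)"
  by (simp add: case_prod_beta)

lemma run_PrimRec_Suc:
  "psnd x = Suc n \<Longrightarrow> run (PrimRec f g) r x =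
     Option.bind (run (PrimRec f g) r (pair (pfst x) n)) (\<lambda>h. run g r (triple (pfst x) n h))"
  by (simp add: case_prod_beta)

text \<open>
  Written positively, success of a search is exactly what a table can record: the zero, and a
  successor value at every earlier argument.
\<close>

lemma least_zero_eq_Some_iff:
  "least_zero f = Some n \<longleftrightarrow> f n = Some 0 \<and> (\<forall>m<n. \<exists>h. f m = Some (Suc h))"
proof
  assume "least_zero f = Some n"
  then obtain k where k: "f k = Some 0" "\<forall>m<k. f m \<noteq> None" and n: "n = (LEAST n. f n = Some 0)"
    unfolding least_zero_def by (metis option.distinct(1) option.inject)
  have fn: "f n = Some 0" unfolding n by (rule LeastI[of _ k]) (rule k)
  have "n \<le> k" unfolding n by (rule Least_le) (rule k)
  have "\<exists>h. f m = Some (Suc h)" if "m < n" for m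
  proof -
    have "f m \<noteq> Some 0" using that unfolding n by (rule not_less_Least)
    moreover have "f m \<noteq> None" using that \<open>n \<le> k\<close> k(2) by auto
    ultimately show ?thesis by (metis not0_implies_Suc option.exhaust)
  qed
  with fn show "f n = Some 0 \<and> (\<forall>m<n. \<exists>h. f m = Some (Suc h))" by blast
next
  assume *: "f n = Some 0 \<and> (\<forall>m<n. \<exists>h. f m = Some (Suc h))"
  have "(LEAST n. f n = Some 0) = n"
  proof (rule Least_equality)
    show "n \<le> m" if "f m = Some 0" for m
      using * that by (metis nat.distinct(1) not_le option.inject)
  qed (use * in simp)
  moreover have "\<exists>n. f n = Some 0 \<and> (\<forall>m<n. f m \<noteq> None)"
    using * by (metis option.distinct(1))
  ultimately show "least_zero f = Some n" by (simp add: least_zero_def)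
qed

lemma justified_sound:
  assumes j: "justified r l R i x v"
    and R: "\<And>a y w. triple a y w \<in> R \<Longrightarrow> run (prog_of a) r' y = Some w"
    and r': "\<And>j. j < l \<Longrightarrow> r' j = r j"
  shows "run (prog_of i) r' x = Some v"
proof (cases "i < 5")
  case True
  then show ?thesis
    using j r' less_5_cases[of i] by (auto simp: justified_def prog_of_base)
next
  case False
  define k a b where "k = (i - 5) div 4" and "a = pfst k" and "b = psnd k"
  have i: "i \<noteq> 0" "i \<noteq> 1" "i \<noteq> 2" "i \<noteq> 3" "i \<noteq> 4" using False by auto
  note j' = j[unfolded justified_def Let_def, folded k_def, folded a_def b_def]
  note p = prog_of_rec[OF False, unfolded Let_def, folded k_def, folded a_def b_def]
  consider "(i - 5) mod 4 = 0" | "(i - 5) mod 4 = 1" | "(i - 5) mod 4 = 2" | "(i - 5) mod 4 = 3"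
    by linarith
  then show ?thesis
  proof cases
    case 1
    then have "triple a x (pfst v) \<in> R" "triple b x (psnd v) \<in> R" "prog_of i = Tuple (prog_of a) (prog_of b)"
      using j' i p by auto
    then show ?thesis by (auto dest!: R)
  next
    case 2
    then obtain m where "triple b x m \<in> R" "triple a m v \<in> R"
      using j' i by auto
    moreover have "prog_of i = Compose (prog_of a) (prog_of b)" using p 2 by simp
    ultimately show ?thesis by (auto dest!: R)
  next
    case 3
    then have pi: "prog_of i = PrimRec (prog_of a) (prog_of b)" using p by simp
    show ?thesis
    proof (cases "psnd x")
      case 0
      then have "triple a (pfst x) v \<in> R" using j' i 3 by simp
      then show ?thesis unfolding pi run_PrimRec_0[OF 0] by (rule R)
    next
      case (Suc n)
      then obtain h where h: "triple i (pair (pfst x) n) h \<in> R" "triple b (triple (pfst x) n h) v \<in> R"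
        using j' i 3 by auto
      show ?thesis
        unfolding pi run_PrimRec_Suc[OF Suc] R[OF h(1), unfolded pi] using R[OF h(2)] by simp
    qed
  next
    case 4
    then have pi: "prog_of i = Search (prog_of k)" using p by simp
    have "triple k (pair x v) 0 \<in> R" "\<forall>m<v. \<exists>h. triple k (pair x m) (Suc h) \<in> R"
      using j' i 4 by auto
    then show ?thesis unfolding pi run.simps least_zero_eq_Some_iff using R by blast
  qed
qed

lemma valid_table_sound:
  assumes "valid_table r l xs" and r': "\<And>j. j < l \<Longrightarrow> r' j = r j"
  shows "triple i x v \<in> set xs \<Longrightarrow> run (prog_of i) r' x = Some v"
  using assms(1)
proof (induction xs arbitrary: i x v)
  case (Cons e es)
  then have es: "\<And>i x v. triple i x v \<in> set es \<Longrightarrow> run (prog_of i) r' x = Some v" by simp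
  show ?case
  proof (cases "triple i x v = e")
    case True
    with Cons.prems(2) have "justified r l (set es) i x v" by auto
    then show ?thesis by (rule justified_sound) (fact es, fact r')
  next
    case False
    with Cons.prems(1) es show ?thesis by auto
  qed
qed simp

definition derivable :: "(nat \<Rightarrow> nat) \<Rightarrow> nat set" where
  "derivable r = {e. \<exists>l xs. valid_table r l xs \<and> e \<in> set xs}"

text \<open>
  Valid tables can be concatenated, so finitely many derivable triples have a common table; this is what
  makes every clause of \<open>run\<close>, including the finitely many tests of a search, derivable.
\<close>

lemma finite_derivable_table:
  assumes "finite F" "F \<subseteq> derivable r"
  shows "\<exists>l xs. valid_table r l xs \<and> F \<subseteq> set xs"
  using assms
proof (induction F)
  case empty
  have "valid_table r 0 []" by simp
  then show ?case by blast
next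
  case (insert e F)
  then obtain l xs l' ys where "valid_table r l xs" "F \<subseteq> set xs" "valid_table r l' ys" "e \<in> set ys"
    unfolding derivable_def by blast
  then have "valid_table r (max l l') (ys @ xs)" "insert e F \<subseteq> set (ys @ xs)"
    by (auto intro!: valid_table_append intro: valid_table_mono)
  then show ?case by blast
qed

lemma derivableI:
  assumes "finite F" "F \<subseteq> derivable r" "justified r l F i x v"
  shows "triple i x v \<in> derivable r"
proof -
  from finite_derivable_table[OF assms(1,2)] obtain l' xs
    where xs: "valid_table r l' xs" "F \<subseteq> set xs" by blast
  have "justified r (max l l') (set xs) i x v"
    using justified_mono[OF assms(3) xs(2)] by simp
  moreover have "valid_table r (max l l') xs" using valid_table_mono[OF xs(1)] by simp
  ultimately have "valid_table r (max l l') (triple i x v # xs)" by simp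
  then show ?thesis unfolding derivable_def by (metis (mono_tags) list.set_intros(1) mem_Collect_eq)
qed

text \<open>
  Completeness of tables. Sub-programs have smaller numbers, which gives the outer induction; a primitive
  recursion refers to the same program with a smaller counter and needs an induction of its own.
\<close>

lemma run_derivable: "run (prog_of i) r x = Some v \<Longrightarrow> triple i x v \<in> derivable r"
proof (induction i arbitrary: x v rule: less_induct)
  case (less i)
  show ?case
  proof (cases "i < 5")
    case True
    then have "justified r (Suc x) {} i x v"
      using less.prems less_5_cases[of i] by (auto simp: justified_def prog_of_base)
    then show ?thesis by (intro derivableI[of "{}"]) auto
  next
    case False
    define k a b where "k = (i - 5) div 4" and "a = pfst k" and "b = psnd k"
    have i: "i \<noteq> 0" "i \<noteq> 1" "i \<noteq> 2" "i \<noteq> 3" "i \<noteq> 4" using False by auto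
    have "k < i" using i(1) by (simp add: k_def div4_less)
    then have "a < i" "b < i"
      unfolding a_def b_def using fst_prod_decode_le snd_prod_decode_le le_less_trans by blast+
    note IH = less.IH[OF \<open>k < i\<close>] less.IH[OF \<open>a < i\<close>] less.IH[OF \<open>b < i\<close>]
    have j': "justified r l R i x v \<longleftrightarrow>
      (if (i - 5) mod 4 = 0 then triple a x (pfst v) \<in> R \<and> triple b x (psnd v) \<in> R
       else if (i - 5) mod 4 = 1 then \<exists>m. triple b x m \<in> R \<and> triple a m v \<in> R
       else if (i - 5) mod 4 = 2 then
         if psnd x = 0 then triple a (pfst x) v \<in> R
         else \<exists>h. triple i (pair (pfst x) (psnd x - Suc 0)) h \<in> R
                \<and> triple b (triple (pfst x) (psnd x - Suc 0) h) v \<in> R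
       else triple k (pair x v) 0 \<in> R \<and> (\<forall>m<v. \<exists>h. triple k (pair x m) (Suc h) \<in> R))" for l R x v
      unfolding justified_def Let_def k_def[symmetric] a_def[symmetric] b_def[symmetric]
      using i by simp
    note p = prog_of_rec[OF False, unfolded Let_def, folded k_def, folded a_def b_def]
    consider "(i - 5) mod 4 = 0" | "(i - 5) mod 4 = 1" | "(i - 5) mod 4 = 2" | "(i - 5) mod 4 = 3"
      by linarith
    then show ?thesis
    proof cases
      case 1
      then have pi: "prog_of i = Tuple (prog_of a) (prog_of b)" using p by simp
      obtain u w where uw: "run (prog_of a) r x = Some u" "run (prog_of b) r x = Some w" "v = pair u w"
        using less.prems unfolding pi by (auto simp: bind_eq_Some_conv)
      show ?thesis
        by (rule derivableI[of "{triple a x u, triple b x w}" _ 0]) (use uw IH 1 in \<open>auto simp: j'\<close>)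
    next
      case 2
      then have pi: "prog_of i = Compose (prog_of a) (prog_of b)" using p by simp
      obtain m where m: "run (prog_of b) r x = Some m" "run (prog_of a) r m = Some v"
        using less.prems unfolding pi by (auto simp: bind_eq_Some_conv)
      show ?thesis
        by (rule derivableI[of "{triple b x m, triple a m v}" _ 0]) (use m IH 2 in \<open>auto simp: j'\<close>)
    next
      case 3
      then have pi: "prog_of i = PrimRec (prog_of a) (prog_of b)" using p by simp
      have "run (PrimRec (prog_of a) (prog_of b)) r (pair y n) = Some v \<Longrightarrow>
          triple i (pair y n) v \<in> derivable r" for y n v
      proof (induction n arbitrary: v)
        case 0
        then have "run (prog_of a) r y = Some v" by simp
        then have "{triple a y v} \<subseteq> derivable r" using IH(2) by simp
        then show ?case by (intro derivableI[of "{triple a y v}" _ 0]) (use 3 in \<open>auto simp: j'\<close>)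
      next
        case (Suc n)
        then obtain h where h: "run (PrimRec (prog_of a) (prog_of b)) r (pair y n) = Some h"
          "run (prog_of b) r (triple y n h) = Some v"
          by (auto simp: bind_eq_Some_conv)
        let ?F = "{triple i (pair y n) h, triple b (triple y n h) v}"
        have "?F \<subseteq> derivable r" using Suc.IH[OF h(1)] IH(3)[OF h(2)] by simp
        then show ?case by (intro derivableI[of ?F _ 0]) (use 3 in \<open>auto simp: j'\<close>)
      qed
      from this[of "pfst x" "psnd x"] show ?thesis using less.prems unfolding pi by simp
    next
      case 4
      then have pi: "prog_of i = Search (prog_of k)" using p by simp
      have run0: "run (prog_of k) r (pair x v) = Some 0"
        and "\<forall>m<v. \<exists>h. run (prog_of k) r (pair x m) = Some (Suc h)"
        using less.prems unfolding pi run.simps least_zero_eq_Some_iff by blast+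
      then obtain h where h: "\<And>m. m < v \<Longrightarrow> run (prog_of k) r (pair x m) = Some (Suc (h m))"
        by metis
      let ?F = "insert (triple k (pair x v) 0) ((\<lambda>m. triple k (pair x m) (Suc (h m))) ` {..<v})"
      have "?F \<subseteq> derivable r" using IH(1)[OF run0] IH(1)[OF h] by auto
      then show ?thesis by (intro derivableI[of ?F _ 0]) (use 4 in \<open>auto simp: j'\<close>)
    qed
  qed
qed

text \<open>
  The bound \<open>s\<close> on the table plays the part of a running time, and \<open>l\<close> bounds the use of the oracle.
\<close>

definition evaluated :: "nat \<Rightarrow> (nat \<Rightarrow> nat) \<Rightarrow> nat \<Rightarrow> nat \<Rightarrow> nat \<Rightarrow> nat \<Rightarrow> bool" where
  "evaluated s r l i x v \<longleftrightarrow>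
     (\<exists>c<s. valid_table r l (list_decode c) \<and> triple i x v \<in> code_members c)"

lemma decidable_evaluated [recursive_intros]:
  assumes R: "recursive (\<lambda>r t. \<rho> r (pfst t) (psnd t))"
    and "recursive S" "recursive L" "recursive I" "recursive X" "recursive V"
  shows "decidable (\<lambda>r z. evaluated (S r z) (\<rho> r z) (L r z) (I r z) (X r z) (V r z))"
proof -
  have R': "recursive (\<lambda>r t. \<rho> r (A r t) (B r t))" if "recursive A" "recursive B" for A B
    using recursive_compose[OF R recursive_pair[OF that]] by simp
  show ?thesis unfolding evaluated_def
    by (intro recursive_intros R' assms(2-) assms(2-)[THEN recursive_compose])
qed

lemma evaluated_mono: "evaluated s r l i x v \<Longrightarrow> s \<le> s' \<Longrightarrow> l \<le> l' \<Longrightarrow> evaluated s' r l' i x v"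
  unfolding evaluated_def using valid_table_mono less_le_trans by blast

lemma evaluated_cong:
  assumes "\<And>j. j < l \<Longrightarrow> r j = r' j"
  shows "evaluated s r l i x v \<longleftrightarrow> evaluated s r' l i x v"
proof -
  have "justified r l R i x v \<longleftrightarrow> justified r' l R i x v" for R i x v
    using assms unfolding justified_def by auto
  then have "valid_table r l xs \<longleftrightarrow> valid_table r' l xs" for xs by (induction xs) auto
  then show ?thesis by (simp add: evaluated_def)
qed

lemma evaluated_sound:
  assumes "evaluated s r l i x v" "\<And>j. j < l \<Longrightarrow> r' j = r j"
  shows "run (prog_of i) r' x = Some v"
  using assms valid_table_sound unfolding evaluated_def code_members_def by blast

lemma evaluated_complete:
  assumes "run (prog_of i) r x = Some v"
  obtains n where "\<And>s l. n \<le> s \<Longrightarrow> n \<le> l \<Longrightarrow> evaluated s r l i x v"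
proof -
  from run_derivable[OF assms] obtain l xs where xs: "valid_table r l xs" "triple i x v \<in> set xs"
    unfolding derivable_def by blast
  have "evaluated (Suc (list_encode xs)) r l i x v"
    unfolding evaluated_def using xs by (intro exI[of _ "list_encode xs"]) (auto simp: code_members_def)
  then show thesis
    by (intro that[of "max (Suc (list_encode xs)) l"]) (auto intro: evaluated_mono)
qed

section \<open>Comeagerness in terms of names\<close>

lemma component_apply: "component p i j = p (pair i j)"
  by (simp add: component_def)

definition ball_union :: "(nat \<Rightarrow> nat) \<Rightarrow> cantor set" where
  "ball_union f = (\<Union>n. basic_ball (f n))"

lemma mem_ball_union: "x \<in> ball_union f \<longleftrightarrow> (\<exists>n. f n \<noteq> 0 \<and> x \<in> cylinder (word (f n - Suc 0)))"
proof -
  have "x \<in> basic_ball k \<longleftrightarrow> k \<noteq> 0 \<and> x \<in> cylinder (word (k - Suc 0))" for k by (cases k) auto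
  then show ?thesis by (auto simp: ball_union_def)
qed

lemma open_ball_union: "open (ball_union f)"
proof -
  have "open (basic_ball k)" for k by (cases k) (auto simp: open_cylinder)
  then show ?thesis unfolding ball_union_def by blast
qed

lemma nowhere_dense_Compl_open_iff:
  fixes U :: "cantor set"
  assumes "open U"
  shows "nowhere_dense (- U) \<longleftrightarrow> (\<forall>n. cylinder (word n) \<inter> U \<noteq> {})"
proof -
  have "closed (- U)" using assms by (rule closed_Compl)
  then show ?thesis unfolding nowhere_dense_iff by auto
qed

text \<open>
  A computable sequence of closed sets is replaced by its name, which is a single computable function.
\<close>

lemma comeager_wrt_iff:
  "comeager_wrt \<delta> A \<longleftrightarrow>
     (\<exists>f. computable_fun f \<and> (\<forall>i. \<exists>C. \<delta> (component f i) = Some C \<and> nowhere_dense C)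
        \<and> A = (\<Inter>i. - the (\<delta> (component f i))))"
proof
  assume "comeager_wrt \<delta> A"
  then obtain C f where f: "computable_fun f" "seq_rep \<delta> f = Some C"
    and C: "\<And>i. nowhere_dense (C i)" "- A = (\<Union>i. C i)"
    unfolding comeager_wrt_def computable_seq_def computable_point_def by blast
  from f(2) have d: "\<delta> (component f i) = Some (C i)" for i
    by (auto simp: seq_rep_def split: if_splits)
  have "A = (\<Inter>i. - the (\<delta> (component f i)))" using C(2) by (auto simp: d)
  with f(1) d C(1) show "\<exists>f. computable_fun f \<and> (\<forall>i. \<exists>C. \<delta> (component f i) = Some C \<and> nowhere_dense C)
        \<and> A = (\<Inter>i. - the (\<delta> (component f i)))" by blast
next
  assume "\<exists>f. computable_fun f \<and> (\<forall>i. \<exists>C. \<delta> (component f i) = Some C \<and> nowhere_dense C)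
        \<and> A = (\<Inter>i. - the (\<delta> (component f i)))"
  then obtain f C where f: "computable_fun f" "\<And>i. \<delta> (component f i) = Some (C i)"
    and C: "\<And>i. nowhere_dense (C i)" "A = (\<Inter>i. - the (\<delta> (component f i)))"
    by metis
  then have "seq_rep \<delta> f = Some C" by (simp add: seq_rep_def)
  moreover have "- A = (\<Union>i. C i)" using C(2) f(2) by auto
  ultimately show "comeager_wrt \<delta> A"
    unfolding comeager_wrt_def computable_seq_def computable_point_def using f(1) C(1) by blast
qed

lemma ce_comeager_iff:
  "ce_comeager A \<longleftrightarrow>
     (\<exists>f. computable_fun f \<and> (\<forall>i n. cylinder (word n) \<inter> ball_union (component f i) \<noteq> {})
        \<and> A = (\<Inter>i. ball_union (component f i)))"
  unfolding ce_comeager_def comeager_wrt_iff closed_neg_rep_def ball_union_def[symmetric]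
  by (simp add: nowhere_dense_Compl_open_iff[OF open_ball_union])

lemma jump_rep_eqI:
  assumes "component p \<longlonglongrightarrow> q"
  shows "jump_rep \<delta> p = \<delta> q"
proof -
  have "(THE q. component p \<longlonglongrightarrow> q) = q"
    by (rule the_equality) (use assms baire_limit_unique in blast)+
  then show ?thesis using assms unfolding jump_rep_def convergent_def by auto
qed

lemma jump_rep_eq_Some:
  assumes "jump_rep \<delta> p = Some y"
  obtains q where "component p \<longlonglongrightarrow> q" "\<delta> q = Some y"
  using assms jump_rep_eqI[of p _ \<delta>]
  by (auto simp: jump_rep_def convergent_def split: if_splits)

text \<open>
  Convergence in Baire space is pointwise stabilization, so a name in the limit is a computable guess
  \<open>g\<close> at the \<open>n\<close>-th ball of the \<open>i\<close>-th set that is eventually the correct guess \<open>h i n\<close>.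
\<close>

lemma ce_comeager_in_the_limit_iff:
  "ce_comeager_in_the_limit A \<longleftrightarrow>
     (\<exists>g h. computable_fun g \<and> (\<forall>i n. eventually (\<lambda>s. g (triple i s n) = h i n) sequentially)
        \<and> (\<forall>i n. cylinder (word n) \<inter> ball_union (h i) \<noteq> {})
        \<and> A = (\<Inter>i. ball_union (h i)))" (is "?L \<longleftrightarrow> ?R")
proof
  assume ?L
  then obtain g where g: "computable_fun g"
    "\<And>i. \<exists>C. jump_rep closed_neg_rep (component g i) = Some C \<and> nowhere_dense C"
    "A = (\<Inter>i. - the (jump_rep closed_neg_rep (component g i)))"
    unfolding ce_comeager_in_the_limit_def comeager_wrt_iff by blast
  have "\<exists>h. component (component g i) \<longlonglongrightarrow> h" for i
    using g(2)[of i] jump_rep_eq_Some by metis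
  then obtain h where h: "\<And>i. component (component g i) \<longlonglongrightarrow> h i" by metis
  then have j: "jump_rep closed_neg_rep (component g i) = Some (- ball_union (h i))" for i
    by (simp add: jump_rep_eqI[OF h] closed_neg_rep_def ball_union_def)
  have "eventually (\<lambda>s. g (triple i s n) = h i n) sequentially" for i n
    using h[of i] unfolding tendsto_sequences_iff component_apply by blast
  moreover have "cylinder (word n) \<inter> ball_union (h i) \<noteq> {}" for i n
    using g(2)[of i] unfolding j by (auto simp: nowhere_dense_Compl_open_iff[OF open_ball_union])
  moreover have "A = (\<Inter>i. ball_union (h i))" using g(3) by (simp add: j)
  ultimately show ?R using g(1) by blast
next
  assume ?R
  then obtain g h where g: "computable_fun g"
    and h: "\<And>i n. eventually (\<lambda>s. g (triple i s n) = h i n) sequentially"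
    and d: "\<And>i n. cylinder (word n) \<inter> ball_union (h i) \<noteq> {}" and A: "A = (\<Inter>i. ball_union (h i))"
    by blast
  have lim: "component (component g i) \<longlonglongrightarrow> h i" for i
    unfolding tendsto_sequences_iff component_apply using h by blast
  then have j: "jump_rep closed_neg_rep (component g i) = Some (- ball_union (h i))" for i
    by (simp add: jump_rep_eqI[OF lim] closed_neg_rep_def ball_union_def)
  show ?L
    unfolding ce_comeager_in_the_limit_def comeager_wrt_iff
    by (rule exI[of _ g]) (use g d A in \<open>simp add: j nowhere_dense_Compl_open_iff[OF open_ball_union]\<close>)
qed

lemma cantor_rep_eq_Some_iff: "cantor_rep p = Some x \<longleftrightarrow> p = as_fun x"
proof
  assume "cantor_rep p = Some x"
  then have "range p \<subseteq> {0, 1}" and x: "x = (\<lambda>n. p n = 1)"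
    by (auto simp: cantor_rep_def split: if_splits)
  then have "p n = 0 \<or> p n = 1" for n by (metis insertE rangeI singletonD subsetD)
  then have "p n = as_fun x n" for n unfolding x as_fun_def by (metis of_bool_def)
  then show "p = as_fun x" by blast
qed (auto simp: cantor_rep_def as_fun_def of_bool_def)

lemma computable_iff: "computable x \<longleftrightarrow> decidable (\<lambda>r. x)"
  unfolding computable_def computable_point_def cantor_rep_eq_Some_iff computable_fun_iff decidable_def
  by (simp add: as_fun_def)

lemma computable_seq_cantorI:
  assumes "decidable (\<lambda>r t. x (pfst t) (psnd t))"
  shows "computable_seq cantor_rep x"
proof -
  define p where "p = (\<lambda>t. of_bool (x (pfst t) (psnd t)) :: nat)"
  have "computable_fun p"
    unfolding p_def by (intro computable_funI recursive_intros assms)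
  moreover have "cantor_rep (component p i) = Some (x i)" for i
    unfolding cantor_rep_eq_Some_iff by (simp add: component_def as_fun_def p_def)
  then have "seq_rep cantor_rep p = Some x" by (simp add: seq_rep_def)
  ultimately show ?thesis unfolding computable_seq_def computable_point_def by blast
qed

text \<open>
  A name in the positive representation is a computable family of points \<open>x i n\<close>, of which only
  those with \<open>Q i n\<close> are kept; the others are the added point at infinity.
\<close>

lemma co_ce_comeager_iff:
  "co_ce_comeager A \<longleftrightarrow>
     (\<exists>Q x. decidable (\<lambda>r t. Q (pfst t) (psnd t))
        \<and> decidable (\<lambda>r t. x (pfst t) (pfst (psnd t)) (psnd (psnd t)))
        \<and> (\<forall>i. nowhere_dense (closure {x i n |n. Q i n}))
        \<and> A = (\<Inter>i. - closure {x i n |n. Q i n}))" (is "?L \<longleftrightarrow> ?R")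
proof
  assume ?L
  then obtain p where p: "computable_fun p"
    "\<And>i. \<exists>C. closed_pos_rep (component p i) = Some C \<and> nowhere_dense C"
    "A = (\<Inter>i. - the (closed_pos_rep (component p i)))"
    unfolding co_ce_comeager_def comeager_wrt_iff by blast
  define Q where "Q i n \<longleftrightarrow> p (triple i n 0) = 0" for i n
  define x where "x i n k \<longleftrightarrow> p (triple i n (Suc k)) = 1" for i n k
  have c: "closed_pos_rep (component p i) = Some (closure {x i n |n. Q i n})" for i
  proof -
    obtain s where s: "seq_rep cantor_infty_rep (component p i) = Some s"
      "closed_pos_rep (component p i) = Some (closure (Inl -` range s))"
      using p(2)[of i] by (auto simp: closed_pos_rep_def)
    then have sn: "cantor_infty_rep (component (component p i) n) = Some (s n)" for n
      by (auto simp: seq_rep_def split: if_splits)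
    have x': "x i n = (\<lambda>k. p (triple i n (Suc k)) = 1)" for n by (simp add: x_def fun_eq_iff)
    have "s n = Inl y \<longleftrightarrow> Q i n \<and> y = x i n" for n y
      using sn[of n] unfolding cantor_infty_rep_def component_apply Q_def
      by (auto split: if_splits simp: cantor_rep_def x')
    then have "Inl -` range s = {x i n |n. Q i n}" by (auto simp: image_iff eq_commute[of "Inl _"])
    with s(2) show ?thesis by simp
  qed
  have "decidable (\<lambda>r t. Q (pfst t) (psnd t))"
    unfolding Q_def by (intro recursive_intros recursive_computable_fun[OF p(1)])
  moreover have "decidable (\<lambda>r t. x (pfst t) (pfst (psnd t)) (psnd (psnd t)))"
    unfolding x_def by (intro recursive_intros recursive_computable_fun[OF p(1)])
  ultimately show ?R using p(2,3) unfolding c by auto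
next
  assume ?R
  then obtain Q x where Q: "decidable (\<lambda>r t. Q (pfst t) (psnd t))"
    and x: "decidable (\<lambda>r t. x (pfst t) (pfst (psnd t)) (psnd (psnd t)))"
    and C: "\<And>i. nowhere_dense (closure {x i n |n. Q i n})"
    and A: "A = (\<Inter>i. - closure {x i n |n. Q i n})" by blast
  have Q': "decidable (\<lambda>r t. Q (F r t) (G r t))" if "recursive F" "recursive G" for F G
    using decidable_compose[OF Q recursive_pair[OF that]] by simp
  have x': "decidable (\<lambda>r t. x (F r t) (G r t) (H r t))" if "recursive F" "recursive G" "recursive H" for F G H
    using decidable_compose[OF x recursive_pair[OF that(1) recursive_pair[OF that(2,3)]]] by simp
  define p where "p t =
    (if Q (pfst t) (pfst (psnd t)) then
       if psnd (psnd t) = 0 then 0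
       else of_bool (x (pfst t) (pfst (psnd t)) (psnd (psnd t) - Suc 0))
     else Suc 0)" for t
  have p: "computable_fun p"
    unfolding p_def by (intro computable_funI recursive_intros Q' x' recursive_pred)
  (* The entry 0 of a point's name selects the summand, so the digits are shifted by one. *)
  have "cantor_infty_rep (component (component p i) n) = Some (if Q i n then Inl (x i n) else Inr ())" for i n
  proof -
    have "cantor_rep (\<lambda>k. of_bool (x i n k)) = Some (x i n)"
      by (simp add: cantor_rep_eq_Some_iff as_fun_def)
    then show ?thesis by (simp add: cantor_infty_rep_def component_apply p_def)
  qed
  then have "seq_rep cantor_infty_rep (component p i)
      = Some (\<lambda>n. if Q i n then Inl (x i n) else Inr ())" for i by (simp add: seq_rep_def)
  moreover have "Inl -` range (\<lambda>n. if Q i n then Inl (x i n) else Inr ()) = {x i n |n. Q i n}" for i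
    by (auto split: if_splits)
  ultimately have c: "closed_pos_rep (component p i) = Some (closure {x i n |n. Q i n})" for i
    by (simp add: closed_pos_rep_def)
  show ?L
    unfolding co_ce_comeager_def comeager_wrt_iff
    by (rule exI[of _ p]) (use p C A in \<open>simp add: c\<close>)
qed

text \<open>
  The two sequences of closed sets are interleaved on the level of names, so that one argument serves
  all representations.
\<close>

lemma comeager_wrt_Int:
  assumes "comeager_wrt \<delta> A" "comeager_wrt \<delta> B"
  shows "comeager_wrt \<delta> (A \<inter> B)"
proof -
  from assms obtain f g where f: "computable_fun f"
      "\<And>i. \<exists>C. \<delta> (component f i) = Some C \<and> nowhere_dense C" "A = (\<Inter>i. - the (\<delta> (component f i)))"
    and g: "computable_fun g"
      "\<And>i. \<exists>C. \<delta> (component g i) = Some C \<and> nowhere_dense C" "B = (\<Inter>i. - the (\<delta> (component g i)))"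
    unfolding comeager_wrt_iff by blast
  define p where "p t = (if even (pfst t) then f (pair (pfst t div 2) (psnd t))
    else g (pair (pfst t div 2) (psnd t)))" for t
  have p: "computable_fun p"
    unfolding p_def
    by (intro computable_funI recursive_intros recursive_computable_fun[OF f(1)]
        recursive_computable_fun[OF g(1)])
  have even: "component p (2 * i) = component f i" and odd: "component p (Suc (2 * i)) = component g i" for i
    by (auto simp: component_def p_def)
  have split: "(\<forall>i. P i) \<longleftrightarrow> (\<forall>i. P (2 * i)) \<and> (\<forall>i. P (Suc (2 * i)))" for P :: "nat \<Rightarrow> bool"
    by (metis evenE oddE Suc_eq_plus1)
  have "\<forall>i. \<exists>C. \<delta> (component p i) = Some C \<and> nowhere_dense C"
    using f(2) g(2) by (subst split) (simp add: even odd)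
  moreover have "x \<in> A \<inter> B \<longleftrightarrow> (\<forall>i. x \<in> - the (\<delta> (component p i)))" for x
    by (subst split) (simp add: even odd f(3) g(3))
  then have "A \<inter> B = (\<Inter>i. - the (\<delta> (component p i)))" by auto
  ultimately show ?thesis using p unfolding comeager_wrt_iff by blast
qed

section \<open>Halting with a finite part of the oracle\<close>

text \<open>
  The bound \<open>n\<close> limits the time and the use at once. As oracle position \<open>k\<close> of a join with zero holds
  the \<open>(k div 2)\<close>-th digit of \<open>p\<close> or nothing, the first \<open>n\<close> digits of \<open>p\<close> determine the truth value.
\<close>

definition halts_by :: "nat \<Rightarrow> cantor \<Rightarrow> nat \<Rightarrow> bool" where
  "halts_by i p n \<longleftrightarrow> (\<exists>v<n. evaluated n (as_fun (join p (\<lambda>_. False))) n i 0 v)"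

lemma halts_by_mono: "halts_by i p m \<Longrightarrow> m \<le> n \<Longrightarrow> halts_by i p n"
  unfolding halts_by_def using evaluated_mono less_le_trans by blast

lemma halts_by_cong:
  assumes "\<And>j. j < n \<Longrightarrow> p j = q j"
  shows "halts_by i p n \<longleftrightarrow> halts_by i q n"
proof -
  have "as_fun (join p (\<lambda>_. False)) j = as_fun (join q (\<lambda>_. False)) j" if "j < n" for j
    using assms[of "j div 2"] that by (simp add: as_fun_def join_def)
  then show ?thesis unfolding halts_by_def using evaluated_cong by metis
qed

lemma halting_open_iff: "p \<in> halting_open i (\<lambda>_. False) \<longleftrightarrow> (\<exists>n. halts_by i p n)"
proof
  assume "p \<in> halting_open i (\<lambda>_. False)"
  then obtain v where "run (prog_of i) (as_fun (join p (\<lambda>_. False))) 0 = Some v"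
    by (auto simp: halting_open_def phi_def)
  then obtain n where "\<And>s l. n \<le> s \<Longrightarrow> n \<le> l \<Longrightarrow>
      evaluated s (as_fun (join p (\<lambda>_. False))) l i 0 v"
    using evaluated_complete by blast
  then have "halts_by i p (max n (Suc v))" unfolding halts_by_def by (intro exI[of _ v]) simp
  then show "\<exists>n. halts_by i p n" ..
next
  assume "\<exists>n. halts_by i p n"
  then show "p \<in> halting_open i (\<lambda>_. False)"
    unfolding halts_by_def halting_open_def phi_def using evaluated_sound by fastforce
qed

lemma decidable_halts_by [recursive_intros]:
  assumes "recursive I" "recursive U" "recursive N"
  shows "decidable (\<lambda>r z. halts_by (I r z) (padded (U r z)) (N r z))"
proof -
  have "as_fun (join p (\<lambda>_. False)) k = (if even k then of_bool (p (k div 2)) else 0)" for p k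
    by (simp add: as_fun_def join_def)
  then have R: "recursive (\<lambda>r t. as_fun (join (padded (A r t)) (\<lambda>_. False)) (B r t))"
    if "recursive A" "recursive B" for A B
    by simp (intro recursive_intros that)
  show ?thesis unfolding halts_by_def
    by (intro recursive_intros R assms assms[THEN recursive_compose])
qed

lemma halts_by_imp_cylinder_subset:
  assumes "halts_by i (padded n) (wlen n)"
  shows "cylinder (word n) \<subseteq> halting_open i (\<lambda>_. False)"
proof
  fix x assume "x \<in> cylinder (word n)"
  then have "halts_by i x (wlen n)"
    using assms halts_by_cong[of "wlen n" x "padded n" i] by (simp add: mem_cylinder_word)
  then show "x \<in> halting_open i (\<lambda>_. False)" unfolding halting_open_iff ..
qed

lemma halts_by_prefix_code:
  assumes "halts_by i x m" "m \<le> l"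
  shows "halts_by i (padded (prefix_code x l)) (wlen (prefix_code x l))"
  using halts_by_mono[OF assms] halts_by_cong[of l x "padded (prefix_code x l)" i]
  by (simp add: padded_prefix_code)

definition extends :: "nat \<Rightarrow> nat \<Rightarrow> bool" where
  "extends v n \<longleftrightarrow> wlen n \<le> wlen v \<and> (\<forall>j<wlen n. padded v j = padded n j)"

lemma decidable_extends [recursive_intros]:
  assumes "recursive F" "recursive G"
  shows "decidable (\<lambda>r z. extends (F r z) (G r z))"
  unfolding extends_def by (intro recursive_intros assms assms[THEN recursive_compose])

text \<open>
  Meeting a halting set is a c.e. property of a word: a finite extension at which the program halts is a
  witness.
\<close>

lemma cylinder_meets_halting_open_iff:
  "cylinder (word n) \<inter> halting_open i (\<lambda>_. False) \<noteq> {} \<longleftrightarrow>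
     (\<exists>v. halts_by i (padded v) (wlen v) \<and> extends v n)"
proof
  assume "cylinder (word n) \<inter> halting_open i (\<lambda>_. False) \<noteq> {}"
  then obtain x m where x: "x \<in> cylinder (word n)" "halts_by i x m"
    unfolding halting_open_iff[symmetric] by (auto simp: halting_open_iff)
  let ?v = "prefix_code x (max m (wlen n))"
  have "extends ?v n" using x(1) by (auto simp: extends_def mem_cylinder_word padded_prefix_code)
  moreover have "halts_by i (padded ?v) (wlen ?v)" using halts_by_prefix_code[OF x(2)] by simp
  ultimately show "\<exists>v. halts_by i (padded v) (wlen v) \<and> extends v n" by blast
next
  assume "\<exists>v. halts_by i (padded v) (wlen v) \<and> extends v n"
  then obtain v where v: "halts_by i (padded v) (wlen v)" "extends v n" by blast
  then have "padded v \<in> cylinder (word n)" by (simp add: extends_def mem_cylinder_word)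
  moreover have "padded v \<in> halting_open i (\<lambda>_. False)"
    using v(1) by (auto simp: halting_open_iff)
  ultimately show "cylinder (word n) \<inter> halting_open i (\<lambda>_. False) \<noteq> {}" by blast
qed

section \<open>Generic points\<close>

text \<open>
  Genericity in an arbitrary \<open>q\<close> implies genericity in zero: a program that ignores \<open>q\<close> is obtained by
  replacing its odd oracle positions by zero.
\<close>

lemma one_generic_iff: "one_generic p \<longleftrightarrow> one_generic_in (\<lambda>_. False) p"
proof
  assume "one_generic p"
  then obtain q where q: "one_generic_in q p" unfolding one_generic_def by blast
  have "recursive (\<lambda>r k. if even k then r k else 0)" by (intro recursive_intros)
  then obtain Q where Q: "\<And>r k. run Q r k = Some (if even k then r k else 0)"
    unfolding recursive_def by blast
  have "\<exists>j. halting_open j q = halting_open i (\<lambda>_. False)" for i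
  proof -
    obtain j where j: "prog_of j = subst_oracle Q (prog_of i)" using surj_prog_of by (metis surjD)
    have "run Q (as_fun (join x q)) k = Some (as_fun (join x (\<lambda>_. False)) k)" for x k
      by (simp add: Q as_fun_def join_def)
    then have "run (prog_of j) (as_fun (join x q)) 0
        = run (prog_of i) (as_fun (join x (\<lambda>_. False))) 0" for x
      unfolding j by (rule run_subst_oracle)
    then show ?thesis unfolding halting_open_def phi_def by (intro exI[of _ j]) simp
  qed
  then show "one_generic_in (\<lambda>_. False) p"
    using q unfolding one_generic_in_def by metis
next
  have "computable (\<lambda>_. False)" by (simp add: computable_iff decidable_def recursive_const)
  then show "one_generic p" if "one_generic_in (\<lambda>_. False) p"
    using that unfolding one_generic_def by blast
qed

lemma ce_open_halting_open:
  assumes "decidable N"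
  obtains e where "\<And>q. halting_open e q = {p. \<exists>n. N (as_fun (join p q)) n}"
proof -
  have "recursive (\<lambda>r t. of_bool (\<not> N r (psnd t)))"
    by (intro recursive_intros decidable_compose[OF assms])
  then obtain P where P: "\<forall>r t. run P r t = Some (of_bool (\<not> N r (psnd t)))"
    unfolding recursive_def ..
  obtain e where e: "prog_of e = Search P" using surj_prog_of by (metis surjD)
  have "run (Search P) r 0 \<noteq> None \<longleftrightarrow> (\<exists>n. N r n)" for r
    by (simp add: P least_zero_def)
  then show thesis
    by (intro that[of e]) (simp add: halting_open_def phi_def e)
qed

text \<open>
  Each of the dense open sets is the halting set of a program searching for a ball around its oracle
  point. A prefix of a 1-generic point cannot be disjoint from a dense set, hence it is contained in it.
\<close>

lemma ce_comeager_contains_one_generic: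
  assumes "ce_comeager A" "one_generic p"
  shows "p \<in> A"
proof -
  from assms(1) obtain f where f: "computable_fun f"
    and d: "\<And>i n. cylinder (word n) \<inter> ball_union (component f i) \<noteq> {}"
    and A: "A = (\<Inter>i. ball_union (component f i))" unfolding ce_comeager_iff by blast
  have "p \<in> ball_union (component f i)" for i
  proof -
    (* The digit j of p sits at position j + j of the joined oracle. *)
    define N where "N r n \<longleftrightarrow> f (pair i n) \<noteq> 0 \<and>
      (\<forall>j<wlen (f (pair i n) - Suc 0). (r (j + j) \<noteq> 0) = padded (f (pair i n) - Suc 0) j)"
      for r :: "nat \<Rightarrow> nat" and n
    have "decidable N" unfolding N_def
      by (intro recursive_intros recursive_pred recursive_computable_fun[OF f])
    then obtain e where e: "\<And>q. halting_open e q = {p. \<exists>n. N (as_fun (join p q)) n}"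
      using ce_open_halting_open by blast
    have U: "halting_open e (\<lambda>_. False) = ball_union (component f i)"
      unfolding e N_def by (auto simp: mem_ball_union component_apply mem_cylinder_word as_fun_def join_def)
    obtain w where w: "p \<in> cylinder w"
      "cylinder w \<subseteq> ball_union (component f i) \<or> cylinder w \<inter> ball_union (component f i) = {}"
      using assms(2) unfolding one_generic_iff one_generic_in_def U[symmetric] by blast
    moreover obtain n where "word n = w" using surj_word by (metis surjD)
    ultimately show ?thesis using d[of n i] by blast
  qed
  then show ?thesis unfolding A by blast
qed

text \<open>
  The cylinder \<open>n\<close> is listed if it lies in \<open>U\<^sub>i\<close>, witnessed at the word itself, or if no extension
  inside \<open>U\<^sub>i\<close> exists. The guess at stage \<open>s\<close> trusts disjointness until it is refuted by one of the first
  \<open>s\<close> words, and thus changes at most once.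
\<close>

lemma one_generic_comeager_in_the_limit: "ce_comeager_in_the_limit {p. one_generic p}"
proof -
  define U where "U i = halting_open i (\<lambda>_. False)" for i
  define g where "g t = (let i = pfst t; s = pfst (psnd t); n = psnd (psnd t) in
     if halts_by i (padded n) (wlen n) \<or> \<not> (\<exists>v<s. halts_by i (padded v) (wlen v) \<and> extends v n)
     then Suc n else 0)" for t
  define h where "h i n = (if halts_by i (padded n) (wlen n) \<or> cylinder (word n) \<inter> U i = {}
     then Suc n else 0)" for i n
  have "computable_fun g" unfolding g_def Let_def by (intro computable_funI recursive_intros)
  moreover have "eventually (\<lambda>s. g (triple i s n) = h i n) sequentially" for i n
  proof (cases "\<exists>v. halts_by i (padded v) (wlen v) \<and> extends v n")
    case True
    then obtain v where v: "halts_by i (padded v) (wlen v) \<and> extends v n" by blast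
    have "g (triple i s n) = h i n" if "s \<ge> Suc v" for s
    proof -
      have "\<exists>v<s. halts_by i (padded v) (wlen v) \<and> extends v n"
        using v that by (intro exI[of _ v]) simp
      moreover have "cylinder (word n) \<inter> U i \<noteq> {}"
        using True cylinder_meets_halting_open_iff unfolding U_def by blast
      ultimately show ?thesis by (simp only: g_def h_def Let_def prod_encode_inverse fst_conv snd_conv) simp
    qed
    then show ?thesis unfolding eventually_sequentially by blast
  next
    case False
    then have "cylinder (word n) \<inter> U i = {}"
      using cylinder_meets_halting_open_iff unfolding U_def by blast
    with False have "g (triple i s n) = h i n" for s by (auto simp: g_def h_def)
    then show ?thesis by simp
  qed
  moreover have mem: "x \<in> ball_union (h i) \<longleftrightarrow>
      (\<exists>w. x \<in> cylinder w \<and> (cylinder w \<subseteq> U i \<or> cylinder w \<inter> U i = {}))" for x i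
  proof
    assume "x \<in> ball_union (h i)"
    then obtain n where n: "h i n \<noteq> 0" "x \<in> cylinder (word (h i n - Suc 0))"
      unfolding mem_ball_union by blast
    then show "\<exists>w. x \<in> cylinder w \<and> (cylinder w \<subseteq> U i \<or> cylinder w \<inter> U i = {})"
      using halts_by_imp_cylinder_subset[of i n] unfolding U_def[symmetric]
      by (intro exI[of _ "word n"]) (auto simp: h_def split: if_splits)
  next
    assume "\<exists>w. x \<in> cylinder w \<and> (cylinder w \<subseteq> U i \<or> cylinder w \<inter> U i = {})"
    then obtain w where w: "x \<in> cylinder w" "cylinder w \<subseteq> U i \<or> cylinder w \<inter> U i = {}" by blast
    show "x \<in> ball_union (h i)"
    proof (cases "x \<in> U i")
      case True
      then obtain m where m: "halts_by i x m" unfolding U_def halting_open_iff by blast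
      have "h i (prefix_code x m) = Suc (prefix_code x m)"
        using halts_by_prefix_code[OF m order_refl] by (simp add: h_def)
      then show ?thesis unfolding mem_ball_union
        by (intro exI[of _ "prefix_code x m"]) (simp add: mem_cylinder_prefix_code)
    next
      case False
      obtain n where n: "word n = w" using surj_word by (metis surjD)
      have "h i n = Suc n" using False w n by (auto simp: h_def)
      then show ?thesis unfolding mem_ball_union by (intro exI[of _ n]) (simp add: n w(1))
    qed
  qed
  moreover have "cylinder (word n) \<inter> ball_union (h i) \<noteq> {}" for i n
  proof (cases "cylinder (word n) \<inter> U i = {}")
    case True
    then have "padded n \<in> ball_union (h i)" unfolding mem using padded_in_cylinder by blast
    then show ?thesis using padded_in_cylinder by blast
  next
    case False
    then obtain x m where x: "x \<in> cylinder (word n)" "halts_by i x m"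
      unfolding U_def by (auto simp: halting_open_iff)
    then have "x \<in> ball_union (h i)" unfolding mem U_def
      using halts_by_imp_cylinder_subset[OF halts_by_prefix_code[OF x(2) order_refl]]
      by (intro exI[of _ "word (prefix_code x m)"]) (simp add: mem_cylinder_prefix_code)
    with x(1) show ?thesis by blast
  qed
  moreover have "{p. one_generic p} = (\<Inter>i. ball_union (h i))"
    by (auto simp: one_generic_iff one_generic_in_def mem U_def[symmetric])
  ultimately show ?thesis unfolding ce_comeager_in_the_limit_iff by blast
qed

section \<open>Weakening names to names in the limit\<close>

lemma ce_comeager_imp_in_the_limit:
  assumes "ce_comeager A"
  shows "ce_comeager_in_the_limit A"
proof -
  from assms obtain f where f: "computable_fun f"
    and d: "\<And>i n. cylinder (word n) \<inter> ball_union (component f i) \<noteq> {}"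
    and A: "A = (\<Inter>i. ball_union (component f i))" unfolding ce_comeager_iff by blast
  define g where "g t = f (pair (pfst t) (psnd (psnd t)))" for t
  have "computable_fun g"
    unfolding g_def by (intro computable_funI recursive_intros recursive_computable_fun[OF f])
  moreover have "eventually (\<lambda>s. g (triple i s n) = component f i n) sequentially" for i n
    by (simp add: g_def component_apply)
  ultimately show ?thesis using d A unfolding ce_comeager_in_the_limit_iff by blast
qed

text \<open>
  The complement of a closure is the union of the cylinders that contain no point of the dense sequence.
  A cylinder is listed until one of the first \<open>s\<close> points is found in it.
\<close>

lemma co_ce_comeager_imp_in_the_limit:
  assumes "co_ce_comeager A"
  shows "ce_comeager_in_the_limit A"
proof -
  from assms obtain Q x where Q: "decidable (\<lambda>r t. Q (pfst t) (psnd t))"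
    and x: "decidable (\<lambda>r t. x (pfst t) (pfst (psnd t)) (psnd (psnd t)))"
    and nd: "\<And>i. nowhere_dense (closure {x i n |n. Q i n})"
    and A: "A = (\<Inter>i. - closure {x i n |n. Q i n})" unfolding co_ce_comeager_iff by blast
  have Q': "decidable (\<lambda>r t. Q (F r t) (G r t))" if "recursive F" "recursive G" for F G
    using decidable_compose[OF Q recursive_pair[OF that]] by simp
  have x': "decidable (\<lambda>r t. x (F r t) (G r t) (H r t))"
    if "recursive F" "recursive G" "recursive H" for F G H
    using decidable_compose[OF x recursive_pair[OF that(1) recursive_pair[OF that(2,3)]]] by simp
  define hit where "hit i m n \<longleftrightarrow> Q i m \<and> (\<forall>k<wlen n. x i m k = padded n k)" for i m n
  define g where "g t = (if \<exists>m<pfst (psnd t). hit (pfst t) m (psnd (psnd t)) then 0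
     else Suc (psnd (psnd t)))" for t
  define h where "h i n = (if \<exists>m. hit i m n then 0 else Suc n)" for i n
  have "computable_fun g"
    unfolding g_def hit_def by (intro computable_funI recursive_intros Q' x')
  moreover have "eventually (\<lambda>s. g (triple i s n) = h i n) sequentially" for i n
  proof (cases "\<exists>m. hit i m n")
    case True
    then obtain m where m: "hit i m n" by blast
    have "g (triple i s n) = h i n" if "s \<ge> Suc m" for s
    proof -
      have "\<exists>m<s. hit i m n" using m that by (intro exI[of _ m]) simp
      with True show ?thesis by (simp add: g_def h_def)
    qed
    then show ?thesis unfolding eventually_sequentially by blast
  qed (simp add: g_def h_def)
  moreover have U: "ball_union (h i) = - closure {x i n |n. Q i n}" for i
  proof -
    have ball: "y \<in> ball_union (h i) \<longleftrightarrow> (\<exists>n. y \<in> cylinder (word n) \<and> \<not> (\<exists>m. hit i m n))" for y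
      by (auto simp: mem_ball_union h_def)
    have "(\<exists>n. y \<in> cylinder (word n) \<and> \<not> (\<exists>m. hit i m n)) \<longleftrightarrow> (\<exists>l. \<forall>m. Q i m \<longrightarrow> \<not> (\<forall>j<l. x i m j = y j))" for y
    proof
      assume "\<exists>n. y \<in> cylinder (word n) \<and> \<not> (\<exists>m. hit i m n)"
      then obtain n where n: "y \<in> cylinder (word n)" "\<And>m. \<not> hit i m n" by blast
      have "Q i m \<longrightarrow> \<not> (\<forall>j<wlen n. x i m j = y j)" for m
        using n(1) n(2)[of m] unfolding hit_def mem_cylinder_word by auto
      then show "\<exists>l. \<forall>m. Q i m \<longrightarrow> \<not> (\<forall>j<l. x i m j = y j)" by blast
    next
      assume "\<exists>l. \<forall>m. Q i m \<longrightarrow> \<not> (\<forall>j<l. x i m j = y j)"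
      then obtain l where "\<forall>m. Q i m \<longrightarrow> \<not> (\<forall>j<l. x i m j = y j)" ..
      then show "\<exists>n. y \<in> cylinder (word n) \<and> \<not> (\<exists>m. hit i m n)"
        by (intro exI[of _ "prefix_code y l"])
          (auto simp: mem_cylinder_prefix_code hit_def padded_prefix_code)
    qed
    moreover have cl: "y \<in> closure {x i n |n. Q i n} \<longleftrightarrow>
        (\<forall>l. \<exists>m. Q i m \<and> (\<forall>j<l. x i m j = y j))" for y
      unfolding mem_closure_sequences by blast
    ultimately have "y \<in> ball_union (h i) \<longleftrightarrow> y \<in> - closure {x i n |n. Q i n}" for y
      unfolding ball by (simp add: cl)
    then show ?thesis by blast
  qed
  moreover have "cylinder (word n) \<inter> ball_union (h i) \<noteq> {}" for i n
    using nd[of i] nowhere_dense_Compl_open_iff[OF open_ball_union, of "h i"] unfolding U by simp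
  ultimately show ?thesis using A unfolding ce_comeager_in_the_limit_iff by blast
qed

section \<open>Effective Baire category\<close>

text \<open>
  One step of the Baire construction, with its witness packed into one number \<open>c\<close>: a word \<open>v'\<close> properly
  extending \<open>v\<close> and the index \<open>m\<close> of a ball of the dense open set that contains the cylinder of \<open>v'\<close>.
  Letting the search run through such pairs makes the test decidable.
\<close>

definition refines :: "(nat \<Rightarrow> nat) \<Rightarrow> nat \<Rightarrow> nat \<Rightarrow> bool" where
  "refines f v c \<longleftrightarrow> (let v' = pfst c; m = psnd c in
     wlen v < wlen v' \<and> extends v' v \<and> f m \<noteq> 0 \<and> extends v' (f m - Suc 0))"

primrec baire_words :: "(nat \<Rightarrow> nat \<Rightarrow> nat) \<Rightarrow> nat \<Rightarrow> nat \<Rightarrow> nat" where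
  "baire_words h v 0 = v"
| "baire_words h v (Suc i) = pfst (LEAST c. refines (h i) (baire_words h v i) c)"

text \<open>
  Every step towards a dense open set lengthens the word, so the word after \<open>j + 1\<close> steps has more
  than \<open>j\<close> letters and its digit \<open>j\<close> is final.
\<close>

definition baire_point :: "(nat \<Rightarrow> nat \<Rightarrow> nat) \<Rightarrow> nat \<Rightarrow> cantor" where
  "baire_point h v = (\<lambda>j. padded (baire_words h v (Suc j)) j)"

lemma refines_exists:
  assumes "cylinder (word v) \<inter> ball_union f \<noteq> {}"
  shows "\<exists>c. refines f v c"
proof -
  from assms obtain x m where x: "x \<in> cylinder (word v)" "f m \<noteq> 0" "x \<in> cylinder (word (f m - Suc 0))"
    by (auto simp: mem_ball_union)
  let ?v = "prefix_code x (Suc (wlen v + wlen (f m - Suc 0)))"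
  have "refines f v (pair ?v m)"
    using x by (simp add: refines_def extends_def padded_prefix_code mem_cylinder_word)
  then show ?thesis ..
qed

lemma extends_trans: "extends u v \<Longrightarrow> extends v w \<Longrightarrow> extends u w"
  unfolding extends_def by simp

lemma baire_point:
  assumes d: "\<And>i n. cylinder (word n) \<inter> ball_union (h i) \<noteq> {}"
  shows "baire_point h v \<in> cylinder (word v)" and "baire_point h v \<in> (\<Inter>i. ball_union (h i))"
proof -
  let ?V = "baire_words h v"
  have step: "refines (h i) (?V i) (LEAST c. refines (h i) (?V i) c)" for i
    using refines_exists[OF d] by (rule LeastI_ex)
  have len: "wlen (?V i) < wlen (?V (Suc i))" and ext: "extends (?V (Suc i)) (?V i)" for i
    using step[of i] by (simp_all add: refines_def Let_def)
  have ext': "extends (?V (i + k)) (?V i)" for i k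
  proof (induction k)
    case 0
    show ?case by (simp add: extends_def)
  next
    case (Suc k)
    then show ?case using extends_trans[OF ext] by simp
  qed
  have i_le: "i \<le> wlen (?V i)" for i
    by (induction i) (use len Suc_leI le_less_trans in blast)+
  have in_cyl: "baire_point h v \<in> cylinder (word (?V i))" for i
    unfolding mem_cylinder_word
  proof (intro allI impI)
    fix j assume j: "j < wlen (?V i)"
    show "baire_point h v j = padded (?V i) j"
    proof (cases "Suc j \<le> i")
      case True
      have "j < wlen (?V (Suc j))" using i_le[of "Suc j"] by simp
      then show ?thesis
        using ext'[of "Suc j" "i - Suc j"] True by (simp add: extends_def baire_point_def)
    next
      case False
      then show ?thesis
        using ext'[of i "Suc j - i"] j by (simp add: extends_def baire_point_def)
    qed
  qed
  from in_cyl[of 0] show "baire_point h v \<in> cylinder (word v)" by simp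
  have "baire_point h v \<in> ball_union (h i)" for i
  proof -
    obtain m where "h i m \<noteq> 0" "extends (?V (Suc i)) (h i m - Suc 0)"
      using step[of i] by (auto simp: refines_def Let_def)
    with in_cyl[of "Suc i"] show ?thesis
      by (auto simp: mem_ball_union mem_cylinder_word extends_def)
  qed
  then show "baire_point h v \<in> (\<Inter>i. ball_union (h i))" by blast
qed

lemma dense_baire_points:
  assumes "\<And>i n. cylinder (word n) \<inter> ball_union (h i) \<noteq> {}"
  shows "closure (range (baire_point h)) = UNIV"
proof -
  have "x \<in> closure (range (baire_point h))" for x
    unfolding mem_closure_sequences
    using baire_point(1)[of h "prefix_code x _", OF assms] by (auto simp: mem_cylinder_prefix_code)
  then show ?thesis by blast
qed

lemma decidable_refines:
  assumes F: "recursive (\<lambda>r t. \<phi> r (pfst t) (psnd t))" and V: "recursive V" and C: "recursive C"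
  shows "decidable (\<lambda>r z. refines (\<phi> r z) (V r z) (C r z))"
proof -
  have F': "recursive (\<lambda>r z. \<phi> r (A r z) (B r z))" if "recursive A" "recursive B" for A B
    using recursive_compose[OF F recursive_pair[OF that]] by simp
  show ?thesis unfolding refines_def Let_def
    by (intro recursive_intros recursive_pred F' V C)
qed

lemma ce_comeager_dense_computable:
  assumes "ce_comeager A"
  shows "\<exists>D\<subseteq>A. closure D = UNIV \<and> (\<forall>p\<in>D. computable p)"
proof -
  from assms obtain f where f: "computable_fun f"
    and d: "\<And>i n. cylinder (word n) \<inter> ball_union (component f i) \<noteq> {}"
    and A: "A = (\<Inter>i. ball_union (component f i))" unfolding ce_comeager_iff by blast
  have f': "recursive (\<lambda>r z. component f (F r z) (G r z))" if "recursive F" "recursive G" for F G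
    unfolding component_apply by (intro recursive_intros recursive_computable_fun[OF f] that)
  have step: "recursive (\<lambda>r z. LEAST c. refines (component f (F r z)) (V r z) c)"
    if "recursive F" "recursive V" for F V
  proof (rule recursive_Least)
    show "\<exists>c. refines (component f (F r z)) (V r z) c" for r z using d by (rule refines_exists)
    show "decidable (\<lambda>r t. refines (component f (F r (pfst t))) (V r (pfst t)) (psnd t))"
      by (intro decidable_refines f' recursive_intros that[THEN recursive_compose])
  qed
  (* Unfolding the recursion of the words exposes it to the closure rule for primitive recursion. *)
  have words: "baire_words h v i = rec_nat v (\<lambda>i w. pfst (LEAST c. refines (h i) w c)) i" for h v i
    by (induction i) auto
  have "computable (baire_point (component f) v)" for v
    unfolding computable_iff baire_point_def words
    by (intro recursive_intros step)
  then show ?thesis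
    using dense_baire_points[of "component f", OF d] baire_point(2)[of "component f", OF d] A
    by (intro exI[of _ "range (baire_point (component f))"]) auto
qed

text \<open>
  The approximation replaces the unbounded search by one below \<open>s\<close> and the limit name by its \<open>s\<close>-th guess.
  Once \<open>s\<close> exceeds the true witness \<open>c\<close> and the guesses have stabilized at the finitely many arguments
  that candidates up to \<open>c\<close> refer to, the bounded search finds exactly \<open>c\<close>.
\<close>

lemma baire_words_approximation:
  assumes h: "\<And>i n. eventually (\<lambda>s. g (triple i s n) = h i n) sequentially"
    and d: "\<And>i n. cylinder (word n) \<inter> ball_union (h i) \<noteq> {}"
  shows "eventually (\<lambda>s. rec_nat v (\<lambda>i w. pfst (first_below s (refines (\<lambda>m. g (triple i s m)) w))) i
    = baire_words h v i) sequentially"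
proof (induction i)
  case (Suc i)
  let ?w = "baire_words h v i"
  define c where "c = (LEAST c. refines (h i) ?w c)"
  have c: "refines (h i) ?w c"
    unfolding c_def using refines_exists[OF d] by (rule LeastI_ex)
  have min: "\<not> refines (h i) ?w k" if "k < c" for k
    using that unfolding c_def by (rule not_less_Least)
  have "eventually (\<lambda>s. \<forall>k\<in>{..c}. g (triple i s (psnd k)) = h i (psnd k)) sequentially"
    by (rule eventually_ball_finite) (use h in auto)
  with Suc.IH eventually_gt_at_top[of c] show ?case
  proof eventually_elim
    case (elim s)
    have r: "refines (\<lambda>m. g (triple i s m)) ?w k \<longleftrightarrow> refines (h i) ?w k" if "k \<le> c" for k
      using elim(3) that by (simp add: refines_def Let_def)
    have "first_below s (refines (\<lambda>m. g (triple i s m)) ?w) = c"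
      by (rule first_below_eqI) (use elim(2) r c min in auto)
    with elim(1) show ?case by (simp add: c_def)
  qed
qed simp

lemma ce_comeager_in_the_limit_dense:
  assumes "ce_comeager_in_the_limit A"
  shows "\<exists>D\<subseteq>A. closure D = UNIV \<and> (\<forall>p\<in>D. computable_in_the_limit p)"
proof -
  from assms obtain g h where g: "computable_fun g"
    and h: "\<And>i n. eventually (\<lambda>s. g (triple i s n) = h i n) sequentially"
    and d: "\<And>i n. cylinder (word n) \<inter> ball_union (h i) \<noteq> {}"
    and A: "A = (\<Inter>i. ball_union (h i))" unfolding ce_comeager_in_the_limit_iff by blast
  have "computable_in_the_limit (baire_point h v)" for v
  proof -
    define x where "x s j = padded
      (rec_nat v (\<lambda>i w. pfst (first_below s (refines (\<lambda>m. g (triple i s m)) w))) (Suc j)) j" for s j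
    have "computable_seq cantor_rep x"
      unfolding x_def
      by (intro computable_seq_cantorI recursive_intros decidable_refines recursive_computable_fun[OF g])
    moreover have "x \<longlonglongrightarrow> baire_point h v"
      unfolding tendsto_sequences_iff
    proof
      fix j
      show "eventually (\<lambda>s. x s j = baire_point h v j) sequentially"
        using baire_words_approximation[of g h v "Suc j", OF h d]
        by (rule eventually_mono) (simp only: x_def baire_point_def)
    qed
    ultimately show ?thesis unfolding computable_in_the_limit_def by blast
  qed
  then show ?thesis
    using dense_baire_points[of h, OF d] baire_point(2)[of h, OF d] A
    by (intro exI[of _ "range (baire_point h)"]) auto
qed

lemma comeager_UNIV:
  "ce_comeager UNIV" "co_ce_comeager UNIV" "ce_comeager_in_the_limit UNIV"
proof -
  show "ce_comeager UNIV"
    unfolding ce_comeager_iff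
  proof (intro exI conjI allI)
    show "computable_fun (\<lambda>_. Suc 0)" by (intro computable_funI recursive_intros)
    have U: "ball_union (component (\<lambda>_. Suc 0) i) = UNIV" for i
      by (auto simp: mem_ball_union component_apply cylinder_def)
    show "UNIV = (\<Inter>i. ball_union (component (\<lambda>_. Suc 0) i))" by (simp add: U)
    show "cylinder (word n) \<inter> ball_union (component (\<lambda>_. Suc 0) i) \<noteq> {}" for i n
      using padded_in_cylinder by (auto simp: U)
  qed
  then show "ce_comeager_in_the_limit UNIV" by (rule ce_comeager_imp_in_the_limit)
  show "co_ce_comeager UNIV"
    unfolding co_ce_comeager_iff
    by (rule exI[of _ "\<lambda>_ _. False"], rule exI[of _ "\<lambda>_ _ _. False"])
      (auto simp: decidable_def recursive_const nowhere_dense_def)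
qed

section \<open>The non-computable points\<close>

text \<open>
  The outputs of program \<open>i\<close> computed within \<open>n\<close> steps, up to the first argument without a binary output,
  and zeros from there on.
\<close>

definition approximation :: "nat \<Rightarrow> nat \<Rightarrow> cantor" where
  "approximation i n = (\<lambda>j. evaluated n (\<lambda>_. 0) n i j 1 \<and>
     (\<forall>k<Suc j. evaluated n (\<lambda>_. 0) n i k 0 \<or> evaluated n (\<lambda>_. 0) n i k 1))"

lemma decidable_approximation:
  assumes "recursive I" "recursive N" "recursive J"
  shows "decidable (\<lambda>r z. approximation (I r z) (N r z) (J r z))"
  unfolding approximation_def by (intro recursive_intros assms assms[THEN recursive_compose])

lemma computable_run_iff:
  "computable p \<longleftrightarrow> (\<exists>i. \<forall>j. run (prog_of i) (\<lambda>_. 0) j = Some (of_bool (p j)))"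
  unfolding computable_def computable_point_def cantor_rep_eq_Some_iff computable_fun_def phi_def as_fun_def
  by auto

lemma computable_padded: "computable (padded n)"
  unfolding computable_iff by (intro recursive_intros)

text \<open>
  Diagonalization against all programs behind the given word.
\<close>

lemma cylinder_contains_noncomputable: "\<exists>y\<in>cylinder (word n). \<not> computable y"
proof -
  (* The point computed by program k, and an arbitrary one if program k computes none. *)
  define e where "e k = (SOME p. \<forall>j. run (prog_of k) (\<lambda>_. 0) j = Some (of_bool (p j)))" for k
  define y where "y j = (if j < wlen n then padded n j else \<not> e (j - wlen n) j)" for j
  have "\<not> computable y"
  proof
    assume "computable y"
    then obtain k where k: "\<forall>j. run (prog_of k) (\<lambda>_. 0) j = Some (of_bool (y j))"
      unfolding computable_run_iff by blast
    then have "\<forall>j. run (prog_of k) (\<lambda>_. 0) j = Some (of_bool (e k j))"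
      unfolding e_def by (rule someI[where P = "\<lambda>p. \<forall>j. run (prog_of k) (\<lambda>_. 0) j = Some (of_bool (p j))"])
    with k have "of_bool (y (wlen n + k)) = (of_bool (e k (wlen n + k)) :: nat)"
      by (metis option.inject)
    then show False by (cases "e k (wlen n + k)") (simp_all add: y_def)
  qed
  moreover have "y \<in> cylinder (word n)" by (simp add: mem_cylinder_word y_def)
  ultimately show ?thesis by blast
qed

lemma evaluated_unique: "evaluated s r l i x v \<Longrightarrow> evaluated s' r l' i x v' \<Longrightarrow> v = v'"
  using evaluated_sound[of s r l i x v r] evaluated_sound[of s' r l' i x v' r] by simp

lemma computable_in_closure_approximation:
  assumes "computable p"
  shows "\<exists>i. p \<in> closure (range (approximation i))"
proof -
  from assms obtain i where i: "\<And>j. run (prog_of i) (\<lambda>_. 0) j = Some (of_bool (p j))"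
    unfolding computable_run_iff by blast
  have "\<exists>n. \<forall>s l. n \<le> s \<longrightarrow> n \<le> l \<longrightarrow> evaluated s (\<lambda>_. 0) l i j (of_bool (p j))" for j
    using evaluated_complete[OF i[of j]] by metis
  then obtain n where n: "\<And>j s l. n j \<le> s \<Longrightarrow> n j \<le> l \<Longrightarrow>
      evaluated s (\<lambda>_. 0) l i j (of_bool (p j))" by metis
  have "\<exists>y\<in>range (approximation i). \<forall>j<l. y j = p j" for l
  proof -
    define m where "m = Max (insert 0 (n ` {..<l}))"
    have ev: "evaluated m (\<lambda>_. 0) m i j (of_bool (p j))" if "j < l" for j
    proof -
      have "n j \<le> m" unfolding m_def using that by (intro Max_ge) auto
      then show ?thesis by (intro n)
    qed
    have "approximation i m j = p j" if "j < l" for j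
    proof -
      have "evaluated m (\<lambda>_. 0) m i k 0 \<or> evaluated m (\<lambda>_. 0) m i k 1" if "k < Suc j" for k
        using ev[of k] that \<open>j < l\<close> by (cases "p k") auto
      moreover have "evaluated m (\<lambda>_. 0) m i j 1 \<longleftrightarrow> p j"
        using ev[OF that] evaluated_unique[of m "\<lambda>_. 0" m i j 1 m m "of_bool (p j)"]
        by (cases "p j") auto
      ultimately show ?thesis unfolding approximation_def by blast
    qed
    then show ?thesis by blast
  qed
  then show ?thesis unfolding mem_closure_sequences by blast
qed

text \<open>
  If some argument never gets a binary output, all approximations vanish from there on, and so does \<open>y\<close>.
  Otherwise program \<open>i\<close> computes a point, and \<open>y\<close> is either an approximation or this point: being
  different from the first \<open>N\<close> approximations, it is near only to later ones, whose early digits are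
  outputs of the program.
\<close>

lemma closure_approximation_computable:
  assumes y: "y \<in> closure (range (approximation i))"
  shows "computable y"
proof -
  define total where "total j n \<longleftrightarrow>
    (\<forall>k<Suc j. evaluated n (\<lambda>_. 0) n i k 0 \<or> evaluated n (\<lambda>_. 0) n i k 1)" for j n
  have approx: "approximation i n j \<longleftrightarrow> evaluated n (\<lambda>_. 0) n i j 1 \<and> total j n" for n j
    by (simp add: approximation_def total_def)
  have near: "\<exists>n. \<forall>j<l. approximation i n j = y j" for l
    using y unfolding mem_closure_sequences by blast
  show ?thesis
  proof (cases "\<forall>j. \<exists>n. total j n")
    case False
    then obtain j where j: "\<And>n. \<not> total j n" by blast
    have "\<not> y k" if "j \<le> k" for k
    proof -
      have "\<not> total k n" for n using j[of n] that le_less_trans unfolding total_def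
        by (meson Suc_le_mono less_le_trans)
      moreover obtain n where "approximation i n k = y k" using near[of "Suc k"] by blast
      ultimately show ?thesis unfolding approx by blast
    qed
    then have "y k \<longleftrightarrow> padded (prefix_code y j) k" for k
      unfolding padded_prefix_code using not_le by blast
    then have "y = padded (prefix_code y j)" by blast
    then show ?thesis by (metis computable_padded)
  next
    case True
    show ?thesis
    proof (cases "y \<in> range (approximation i)")
      case True
      then obtain n where "y = approximation i n" by blast
      moreover have "computable (approximation i n)"
        unfolding computable_iff by (intro decidable_approximation recursive_intros)
      ultimately show ?thesis by simp
    next
      case False
      have "run (prog_of i) (\<lambda>_. 0) j = Some (of_bool (y j))" for j
      proof -
        from True obtain N where N: "total j N" by blast
        have "\<exists>l. approximation i n l \<noteq> y l" for n using False by fastforce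
        then obtain d where d: "\<And>n. approximation i n (d n) \<noteq> y (d n)" by metis
        (* Agreement with y below l excludes the approximations before N and settles digit j. *)
        define l where "l = Max (insert (Suc j) ((\<lambda>n. Suc (d n)) ` {..<N}))"
        have l: "Suc j \<le> l" "\<And>n. n < N \<Longrightarrow> Suc (d n) \<le> l" unfolding l_def by (auto intro: Max_ge)
        obtain n where n: "\<And>j. j < l \<Longrightarrow> approximation i n j = y j" using near by blast
        have "N \<le> n"
        proof (rule ccontr)
          assume "\<not> N \<le> n"
          then have "d n < l" using l(2)[of n] by simp
          with n d show False by blast
        qed
        then have "total j n" using N evaluated_mono unfolding total_def by meson
        then have "evaluated n (\<lambda>_. 0) n i j 0 \<or> evaluated n (\<lambda>_. 0) n i j 1" by (simp add: total_def)
        moreover have "y j \<longleftrightarrow> evaluated n (\<lambda>_. 0) n i j 1"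
          using n[of j] l(1) \<open>total j n\<close> unfolding approx by simp
        ultimately have "evaluated n (\<lambda>_. 0) n i j (of_bool (y j))" by (cases "y j") auto
        then show ?thesis by (rule evaluated_sound) simp
      qed
      then show ?thesis unfolding computable_run_iff by blast
    qed
  qed
qed

lemma noncomputable_co_ce_comeager: "co_ce_comeager {p. \<not> computable p}"
  unfolding co_ce_comeager_iff
proof (intro exI conjI allI)
  have range: "{approximation i n |n. True} = range (approximation i)" for i by blast
  show "decidable (\<lambda>r t. True)" by (simp add: decidable_def recursive_const)
  show "decidable (\<lambda>r t. approximation (pfst t) (pfst (psnd t)) (psnd (psnd t)))"
    by (intro decidable_approximation recursive_intros)
  show "nowhere_dense (closure {approximation i n |n. True})" for i
    unfolding nowhere_dense_iff range closure_closure
    using cylinder_contains_noncomputable closure_approximation_computable by blast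
  show "{p. \<not> computable p} = (\<Inter>i. - closure {approximation i n |n. True})"
    unfolding range using computable_in_closure_approximation closure_approximation_computable by blast
qed

section \<open>A co-c.e. comeager set of generic points\<close>

text \<open>
  The words at which the program halts but at no proper prefix. They form a prefix-free set whose
  cylinders partition the halting set.
\<close>

definition first_halting :: "nat \<Rightarrow> nat \<Rightarrow> bool" where
  "first_halting i n \<longleftrightarrow> halts_by i (padded n) (wlen n) \<and> (\<forall>l<wlen n. \<not> halts_by i (padded n) l)"

text \<open>
  Near a boundary point \<open>p\<close> there are points \<open>x\<close> of the halting set. The prefix of \<open>x\<close> at which the program
  first halts must be longer than the common part of \<open>x\<close> and \<open>p\<close>, as otherwise \<open>p\<close> would be in the
  halting set itself; so already this prefix, padded with zeros, is near \<open>p\<close>.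
\<close>

lemma boundary_in_closure_first_halting:
  assumes p: "p \<notin> halting_open i (\<lambda>_. False)"
    and meets: "\<And>n. p \<in> cylinder (word n) \<Longrightarrow> cylinder (word n) \<inter> halting_open i (\<lambda>_. False) \<noteq> {}"
  shows "p \<in> closure {padded n |n. first_halting i n}"
  unfolding mem_closure_sequences
proof
  fix l
  have "p \<in> cylinder (word (prefix_code p l))" by (simp add: mem_cylinder_prefix_code)
  from meets[OF this] obtain x where "x \<in> cylinder (word (prefix_code p l))"
    "x \<in> halting_open i (\<lambda>_. False)" by blast
  then obtain m0 where x: "\<And>j. j < l \<Longrightarrow> x j = p j" "halts_by i x m0"
    unfolding mem_cylinder_prefix_code halting_open_iff by blast
  define m where "m = (LEAST m. halts_by i x m)"
  have m: "halts_by i x m" unfolding m_def using x(2) by (rule LeastI)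
  have least: "\<not> halts_by i x k" if "k < m" for k using that unfolding m_def by (rule not_less_Least)
  have agree: "halts_by i (padded (prefix_code x m)) k \<longleftrightarrow> halts_by i x k" if "k \<le> m" for k
    using that by (intro halts_by_cong) (simp add: padded_prefix_code)
  have "first_halting i (prefix_code x m)"
    using m least agree by (simp add: first_halting_def)
  moreover have "l \<le> m"
  proof (rule ccontr)
    assume "\<not> l \<le> m"
    then have "halts_by i p m" using m halts_by_cong[of m x p i] x(1) by simp
    with p show False unfolding halting_open_iff by blast
  qed
  then have "\<forall>j<l. padded (prefix_code x m) j = p j" using x(1) by (simp add: padded_prefix_code)
  ultimately show "\<exists>y\<in>{padded n |n. first_halting i n}. \<forall>j<l. y j = p j" by blast
qed

lemma first_halting_wlen_eq:
  assumes "first_halting i n" "first_halting i m" "\<And>j. j < wlen n \<Longrightarrow> padded m j = padded n j"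
  shows "wlen m = wlen n"
proof -
  have agree: "halts_by i (padded m) l \<longleftrightarrow> halts_by i (padded n) l" if "l \<le> wlen n" for l
    using assms(3) that by (intro halts_by_cong) simp
  have "\<not> wlen n < wlen m" using assms(1,2) agree[of "wlen n"] by (auto simp: first_halting_def)
  moreover have "\<not> wlen m < wlen n"
    using assms(1,2) agree[of "wlen m"] by (auto simp: first_halting_def)
  ultimately show ?thesis by simp
qed

text \<open>
  Suppose a cylinder is contained in the closure. It contains the chosen point \<open>padded n\<close> of some
  first-halting word \<open>n\<close>; changing a late digit of that point gives another point \<open>y\<close> of the closure in
  the cylinder of \<open>n\<close>. But by prefix-freeness every chosen point near \<open>y\<close> comes from a word of
  the same length as \<open>n\<close> and ends in zeros, so it cannot share the changed digit.
\<close>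

lemma nowhere_dense_first_halting: "nowhere_dense (closure {padded n |n. first_halting i n})"
  unfolding nowhere_dense_iff closure_closure
proof (intro allI notI)
  fix w
  let ?S = "{padded n |n. first_halting i n}"
  assume sub: "cylinder (word w) \<subseteq> closure ?S"
  then have "padded w \<in> closure ?S" using padded_in_cylinder by blast
  then obtain n where n: "first_halting i n" "\<And>j. j < wlen w \<Longrightarrow> padded n j = padded w j"
    unfolding mem_closure_sequences by blast
  (* A position behind both words, so that the change leaves the cylinder of w and the halting time
     of n untouched. *)
  define L where "L = max (wlen n) (wlen w)"
  define y where "y = (padded n)(L := True)"
  have "y \<in> cylinder (word w)" using n(2) by (simp add: mem_cylinder_word y_def L_def)
  with sub have "y \<in> closure ?S" by blast
  then obtain m where m: "first_halting i m" "\<And>j. j < Suc L \<Longrightarrow> padded m j = y j"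
    unfolding mem_closure_sequences by blast
  have "padded m j = padded n j" if "j < wlen n" for j
  proof -
    have "j < L" using that by (simp add: L_def)
    then show ?thesis using m(2)[of j] by (simp add: y_def)
  qed
  then have "wlen m = wlen n" by (rule first_halting_wlen_eq[OF n(1) m(1)])
  then have "\<not> padded m L" by (simp add: padded_def L_def)
  moreover have "padded m L" using m(2)[of L] by (simp add: y_def)
  ultimately show False by blast
qed

lemma co_ce_comeager_subset_one_generic: "\<exists>G. co_ce_comeager G \<and> (\<forall>p\<in>G. one_generic p)"
proof (intro exI conjI ballI)
  let ?G = "\<Inter>i. - closure {padded n |n. first_halting i n}"
  show "co_ce_comeager ?G"
    unfolding co_ce_comeager_iff
  proof (intro exI conjI allI)
    show "decidable (\<lambda>r t. first_halting (pfst t) (psnd t))"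
      unfolding first_halting_def by (intro recursive_intros)
    show "decidable (\<lambda>r t. padded (pfst (psnd t)) (psnd (psnd t)))" by (intro recursive_intros)
    show "nowhere_dense (closure {padded n |n. first_halting i n})" for i
      by (rule nowhere_dense_first_halting)
  qed (rule refl)
  fix p assume p: "p \<in> ?G"
  have "\<exists>w. p \<in> cylinder w \<and> (cylinder w \<subseteq> halting_open i (\<lambda>_. False)
      \<or> cylinder w \<inter> halting_open i (\<lambda>_. False) = {})" for i
  proof (cases "p \<in> halting_open i (\<lambda>_. False)")
    case True
    then obtain m where "halts_by i p m" unfolding halting_open_iff by blast
    from halts_by_imp_cylinder_subset[OF halts_by_prefix_code[OF this order_refl]]
    show ?thesis
      by (intro exI[of _ "word (prefix_code p m)"]) (simp add: mem_cylinder_prefix_code)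
  next
    case False
    with p boundary_in_closure_first_halting show ?thesis by blast
  qed
  then show "one_generic p" unfolding one_generic_iff one_generic_in_def by blast
qed

section \<open>Generic points do not have minimal degree\<close>

text \<open>
  The form in which genericity is applied below: membership in the complement of a halting set is forced
  by a finite part of the point, hence stable under all changes of later digits.
\<close>

lemma one_generic_avoids:
  assumes "one_generic p" "p \<notin> halting_open e (\<lambda>_. False)"
  obtains l where "\<And>x. (\<And>j. j < l \<Longrightarrow> x j = p j) \<Longrightarrow> x \<notin> halting_open e (\<lambda>_. False)"
proof -
  from assms obtain w where w: "p \<in> cylinder w" "cylinder w \<inter> halting_open e (\<lambda>_. False) = {}"
    unfolding one_generic_iff one_generic_in_def by blast
  show thesis
    by (rule that[of "length w"]) (use w in \<open>auto simp: cylinder_def\<close>)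
qed

text \<open>
  Otherwise disagreement with the computable even half is a c.e. open property that \<open>p\<close> does not have
  but that a change of one late even digit produces.
\<close>

lemma one_generic_even_half_noncomputable:
  assumes "one_generic p"
  shows "\<not> computable (\<lambda>n. p (2 * n))"
proof
  assume "computable (\<lambda>n. p (2 * n))"
  then have c: "decidable (\<lambda>r n. p (n + n))" unfolding computable_iff mult_2 .
  (* The digit n of the even half is the digit n + n of the point and the entry n + n + (n + n) of
     the joined oracle. *)
  define N where "N r n \<longleftrightarrow> \<not> ((r (n + n + (n + n)) \<noteq> 0) = p (n + n))"
    for r :: "nat \<Rightarrow> nat" and n
  have "decidable N" unfolding N_def by (intro recursive_intros decidable_compose[OF c])
  then obtain e where e: "\<And>q. halting_open e q = {x. \<exists>n. N (as_fun (join x q)) n}"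
    using ce_open_halting_open by blast
  have "as_fun (join x q) (n + n + (n + n)) \<noteq> 0 \<longleftrightarrow> x (n + n)" for x q n
  proof -
    have "n + n + (n + n) = 2 * (n + n)" by simp
    then show ?thesis by (simp add: as_fun_def join_def)
  qed
  then have mem: "x \<in> halting_open e (\<lambda>_. False) \<longleftrightarrow> (\<exists>n. x (n + n) \<noteq> p (n + n))" for x
    unfolding e N_def by simp
  then have "p \<notin> halting_open e (\<lambda>_. False)" by simp
  then obtain l where l: "\<And>x. (\<And>j. j < l \<Longrightarrow> x j = p j) \<Longrightarrow> x \<notin> halting_open e (\<lambda>_. False)"
    using one_generic_avoids[OF assms] by blast
  have "p(l + l := \<not> p (l + l)) \<notin> halting_open e (\<lambda>_. False)" by (rule l) simp
  moreover have "p(l + l := \<not> p (l + l)) \<in> halting_open e (\<lambda>_. False)"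
    unfolding mem by (intro exI[of _ l]) simp
  ultimately show False by blast
qed

text \<open>
  Let program \<open>i\<close> compute \<open>p\<close> from its even half, and consider the program that searches for a
  disagreement between its oracle point \<open>x\<close> and the output of \<open>i\<close> on the even half of \<open>x\<close>. It does not
  halt for \<open>p\<close>. If a late odd digit of \<open>p\<close> is changed, the even half and with it all outputs of \<open>i\<close> remain
  the same, so the search meets no divergence and finds the changed digit, against genericity.
\<close>

lemma one_generic_not_reducible_to_even_half:
  assumes "one_generic p"
  shows "\<not> turing_reducible p (\<lambda>n. p (2 * n))"
proof
  assume "turing_reducible p (\<lambda>n. p (2 * n))"
  then obtain i where i: "\<And>n. run (prog_of i) (as_fun (\<lambda>n. p (2 * n))) n = Some (as_fun p n)"
    unfolding turing_reducible_def phi_def by blast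
  let ?r = "\<lambda>x. as_fun (join x (\<lambda>_. False))"
  have "recursive (\<lambda>r n. r (n + n + (n + n)))" by (intro recursive_intros)
  then obtain Q where Q: "\<forall>r n. run Q r n = Some (r (n + n + (n + n)))" unfolding recursive_def ..
  define S where "S = subst_oracle Q (prog_of i)"
  have S: "run S (?r x) n = run (prog_of i) (as_fun (\<lambda>n. x (2 * n))) n" for x n
  proof -
    have "run Q (?r x) n = Some (as_fun (\<lambda>n. x (2 * n)) n)" for n
    proof -
      have "n + n + (n + n) = 2 * (2 * n)" by simp
      then show ?thesis by (simp add: Q as_fun_def join_def mult_2)
    qed
    then show ?thesis unfolding S_def by (rule run_subst_oracle)
  qed
  have "recursive (\<lambda>r t. of_bool (pfst t = r (psnd t + psnd t)))" by (intro recursive_intros)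
  then obtain E where E: "\<forall>r t. run E r t = Some (of_bool (pfst t = r (psnd t + psnd t)))"
    unfolding recursive_def ..
  have bit: "?r x (n + n) = as_fun x n" for x n by (simp add: as_fun_def join_def)
  define P where "P = Compose E (Tuple (Compose S Right) Right)"
  have P: "run P (?r x) (pair 0 n) = map_option (\<lambda>u. of_bool (u = as_fun x n))
      (run (prog_of i) (as_fun (\<lambda>n. x (2 * n))) n)" for x n
    by (cases "run (prog_of i) (as_fun (\<lambda>n. x (2 * n))) n")
      (simp_all add: P_def S E bit)
  obtain e where e: "prog_of e = Search P" using surj_prog_of by (metis surjD)
  have "run P (?r p) (pair 0 n) = Some 1" for n unfolding P i by simp
  then have "p \<notin> halting_open e (\<lambda>_. False)"
    by (simp add: halting_open_def phi_def e least_zero_def)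
  then obtain l where l: "\<And>x. (\<And>j. j < l \<Longrightarrow> x j = p j) \<Longrightarrow> x \<notin> halting_open e (\<lambda>_. False)"
    using one_generic_avoids[OF assms] by blast
  define k where "k = Suc (2 * l)"
  define x where "x = p(k := \<not> p k)"
  have "(\<lambda>n. x (2 * n)) = (\<lambda>n. p (2 * n))"
    by (rule ext) (simp add: x_def k_def, presburger)
  then have Px: "run P (?r x) (pair 0 n) = Some (of_bool (as_fun p n = as_fun x n))" for n
    unfolding P by (simp add: i)
  have "\<exists>n. of_bool (as_fun p n = as_fun x n) = (0::nat)"
    by (intro exI[of _ k]) (simp add: x_def as_fun_def)
  then have "x \<in> halting_open e (\<lambda>_. False)"
    using least_zero_total[of "\<lambda>n. of_bool (as_fun p n = as_fun x n)"]
    by (simp add: halting_open_def phi_def e Px)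
  moreover have "x \<notin> halting_open e (\<lambda>_. False)" by (rule l) (simp add: x_def k_def)
  ultimately show False by blast
qed

text \<open>
  The degree of the even half lies strictly between zero and the degree of \<open>p\<close>.
\<close>

lemma one_generic_not_minimal:
  assumes "one_generic p"
  shows "\<not> minimal_turing_degree p"
proof -
  have "recursive (\<lambda>r n. r (n + n))" by (intro recursive_intros)
  then obtain Q where Q: "\<forall>r n. run Q r n = Some (r (n + n))" unfolding recursive_def ..
  obtain i where "prog_of i = Q" using surj_prog_of by (metis surjD)
  then have "turing_reducible (\<lambda>n. p (2 * n)) p"
    unfolding turing_reducible_def phi_def by (intro exI[of _ i]) (simp add: Q as_fun_def mult_2)
  then show ?thesis
    using one_generic_even_half_noncomputable[OF assms]
      one_generic_not_reducible_to_even_half[OF assms]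
    unfolding minimal_turing_degree_def by blast
qed

section \<open>Properties of effectively comeager sets\<close>

theorem corollary9p10:
  fixes A B :: "cantor set"
  shows
   "(ce_comeager UNIV \<and> co_ce_comeager UNIV \<and> ce_comeager_in_the_limit UNIV)
  \<and> (ce_comeager A \<longrightarrow>
       (\<exists>D\<subseteq>A. closure D = UNIV \<and> (\<forall>p\<in>D. computable p)) \<and> {p. one_generic p} \<subseteq> A)
  \<and> (ce_comeager_in_the_limit A \<longrightarrow>
       (\<exists>D\<subseteq>A. closure D = UNIV \<and> (\<forall>p\<in>D. one_generic p \<and> computable_in_the_limit p)))
  \<and> (ce_comeager A \<longrightarrow> (\<exists>C\<subseteq>A. co_ce_comeager C))
  \<and> (ce_comeager A \<or> co_ce_comeager A \<longrightarrow> ce_comeager_in_the_limit A)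
  \<and> ((ce_comeager A \<and> ce_comeager B \<longrightarrow> ce_comeager (A \<inter> B))
     \<and> (co_ce_comeager A \<and> co_ce_comeager B \<longrightarrow> co_ce_comeager (A \<inter> B))
     \<and> (ce_comeager_in_the_limit A \<and> ce_comeager_in_the_limit B
          \<longrightarrow> ce_comeager_in_the_limit (A \<inter> B)))
  \<and> ce_comeager_in_the_limit {p. one_generic p}
  \<and> co_ce_comeager {p. \<not> computable p}
  \<and> (\<exists>G. co_ce_comeager G \<and> (\<forall>p\<in>G. one_generic p) \<and> (\<forall>p\<in>G. \<not> minimal_turing_degree p))"
proof (intro conjI impI)
  show "ce_comeager UNIV" "co_ce_comeager UNIV" "ce_comeager_in_the_limit UNIV"
    by (fact comeager_UNIV)+
  show "\<exists>D\<subseteq>A. closure D = UNIV \<and> (\<forall>p\<in>D. computable p)" if "ce_comeager A"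
    using that by (rule ce_comeager_dense_computable)
  show "{p. one_generic p} \<subseteq> A" if "ce_comeager A"
    using ce_comeager_contains_one_generic[OF that] by blast
  show "\<exists>D\<subseteq>A. closure D = UNIV \<and> (\<forall>p\<in>D. one_generic p \<and> computable_in_the_limit p)"
    if "ce_comeager_in_the_limit A"
  proof -
    have "ce_comeager_in_the_limit (A \<inter> {p. one_generic p})"
      using that one_generic_comeager_in_the_limit comeager_wrt_Int
      unfolding ce_comeager_in_the_limit_def by blast
    from ce_comeager_in_the_limit_dense[OF this] show ?thesis by blast
  qed
  obtain G where G: "co_ce_comeager G" "\<forall>p\<in>G. one_generic p"
    using co_ce_comeager_subset_one_generic by blast
  show "\<exists>C\<subseteq>A. co_ce_comeager C" if "ce_comeager A"
    using G ce_comeager_contains_one_generic[OF that] by blast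
  show "ce_comeager_in_the_limit A" if "ce_comeager A \<or> co_ce_comeager A"
    using that ce_comeager_imp_in_the_limit co_ce_comeager_imp_in_the_limit by blast
  show "ce_comeager (A \<inter> B)" if "ce_comeager A \<and> ce_comeager B"
    using that comeager_wrt_Int unfolding ce_comeager_def by blast
  show "co_ce_comeager (A \<inter> B)" if "co_ce_comeager A \<and> co_ce_comeager B"
    using that comeager_wrt_Int unfolding co_ce_comeager_def by blast
  show "ce_comeager_in_the_limit (A \<inter> B)"
    if "ce_comeager_in_the_limit A \<and> ce_comeager_in_the_limit B"
    using that comeager_wrt_Int unfolding ce_comeager_in_the_limit_def by blast
  show "ce_comeager_in_the_limit {p. one_generic p}" by (fact one_generic_comeager_in_the_limit)
  show "co_ce_comeager {p. \<not> computable p}" by (fact noncomputable_co_ce_comeager)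
  show "\<exists>G. co_ce_comeager G \<and> (\<forall>p\<in>G. one_generic p) \<and> (\<forall>p\<in>G. \<not> minimal_turing_degree p)"
    using G one_generic_not_minimal by blast
qed

end
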